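(* $\displaystyle \mathrm{m}_{\mathbb{D}} \left(y+\frac{1-x}{1+x}\right)=\frac{6}{\pi}L\left(\chi_{-4}, 2\right)- \log 2 - \frac{1}{2} - \frac{1}{\pi}.$
   Context: For a nonzero rational function $P\in\mathbb{C}(x_1,\dots,x_n)$, the (logarithmic) areal Mahler measure is $\mathrm{m}_\mathbb{D}(P)=\frac{1}{\pi^n}\int_{\mathbb{D}^n}\log|P(x_1,\dots,x_n)|\,dA(x_1)\cdots dA(x_n)$, where $\mathbb{D}=\{x\in\mathbb{C}:|x|\le 1\}$ and $dA$ is Lebesgue (area) measure on $\mathbb{C}$. $L(\chi_{-4},s)$ is the Dirichlet $L$-function of the character $\chi_{-4}=\left(\frac{-4}{\cdot}\right)$ of conductor 4. *)

theory Defs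
  imports "HOL-Analysis.Analysis"
begin

definition areal_mahler2 :: "(complex \<Rightarrow> complex \<Rightarrow> complex) \<Rightarrow> real" where
  "areal_mahler2 P =
     (1 / pi ^ 2) * (LINT z : (cball (0::complex) 1 \<times> cball (0::complex) 1) | lborel.
                        ln (cmod (P (fst z) (snd z))))"

definition chi_m4 :: "nat \<Rightarrow> real" where
  "chi_m4 n = (if n mod 4 = 1 then 1 else if n mod 4 = 3 then -1 else 0)"

definition L_chi_m4 :: "real \<Rightarrow> real" where
  "L_chi_m4 s = (\<Sum>n. chi_m4 (Suc n) / real (Suc n) powr s)"

end

theory Submission
  imports Defs
begin

text \<open>
  Write \<open>a = (1 - x) / (1 + x)\<close>. By Jensen's formula on circles, the inner integral of
  \<open>ln \<bar>y + a\<bar>\<close> over the disc is \<open>\<pi> ln \<bar>a\<bar>\<close> if \<open>\<bar>a\<bar> \<ge> 1\<close> and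
  \<open>\<pi> (\<bar>a\<bar>\<^sup>2 - 1) / 2\<close> otherwise, and \<open>\<bar>a\<bar> \<ge> 1\<close> exactly when \<open>Re x \<le> 0\<close>. Folding
  \<open>x\<close> with \<open>-x\<close> leaves two integrals over the right half disc. The one of
  \<open>ln \<bar>1 + x\<bar> - ln \<bar>1 - x\<bar>\<close> is computed in polar coordinates from the power series of the
  logarithm; the one of \<open>2 Re x / \<bar>1 + x\<bar>\<^sup>2\<close> is computed in Cartesian coordinates and reduces
  to the mean of \<open>ln \<bar>1 + e\<^sup>i\<^sup>t\<bar>\<close> over the right half circle, which is again an
  \<open>L\<close>-value by the same power series.
\<close>

subsection \<open>Polar coordinates on the right half plane\<close>

text \<open>Only a half plane needs polar coordinates here: for Re z > 0 the slope of z determines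
  its angle, so they follow from substitutions on the line, and the left half is reached by z -> -z.
  Nothing is lost for circle averages, because ln |a + z| + ln |a - z| = ln |a^2 - z^2| depends on
  twice the angle, and the right half circle is then a full period. The same folding in x replaces a
  by 1/a, so each pair of points meets one logarithmic and one quadratic branch. The obstacle is
  integrability: the integrand is singular along y = -a, and a has a pole at the boundary point x =
  -1. Both are controlled by |ln s| <= s + 1/s and the integrability of 1/|z| over discs. In the
  result, 6/pi collects 2 L and 4 L from the two half-disc integrals; -1/2 and 1/pi stem from the
  Leibniz series, -2/pi and -ln 2 from the boundary terms of the integration by parts.\<close>

lemma borel_measurable_Complex [measurable (raw)]:
  assumes "f \<in> borel_measurable M" "g \<in> borel_measurable M"
  shows "(\<lambda>x. Complex (f x) (g x)) \<in> borel_measurable M"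
proof -
  have "(\<lambda>p. Complex (fst p) (snd p)) \<in> borel_measurable borel"
    by (intro borel_measurable_continuous_onI) (auto intro!: continuous_intros simp: Complex_eq)
  from measurable_compose[OF borel_measurable_Pair[OF assms] this] show ?thesis by simp
qed

lemma borel_measurable_rcis [measurable (raw)]:
  assumes [measurable]: "f \<in> borel_measurable M" "g \<in> borel_measurable M"
  shows "(\<lambda>x. rcis (f x) (g x)) \<in> borel_measurable M"
proof -
  have "rcis r t = Complex (r * cos t) (r * sin t)" for r t
    by (simp add: complex_eq_iff)
  then show ?thesis by simp
qed

lemma borel_measurable_cis [measurable (raw)]:
  "f \<in> borel_measurable M \<Longrightarrow> (\<lambda>x. cis (f x)) \<in> borel_measurable M"
  by (simp add: cis_rcis_eq borel_measurable_rcis)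

text \<open>The principal branch of the tangent, extended by 0 to a total function, so that it can
  serve as the map of a pushforward.\<close>

lemma borel_measurable_tan_restrict [measurable]:
  "(\<lambda>t. if t \<in> {-(pi/2)<..<pi/2} then tan t else (0::real)) \<in> borel_measurable borel"
  by (rule borel_measurable_continuous_on_if)
     (auto intro!: continuous_intros simp: cos_gt_zero_pi less_imp_neq[THEN not_sym])

text \<open>Lebesgue measure is determined by its values on boxes, and a box of complex numbers
  pulls back to a product of two open intervals.\<close>

lemma lborel_complex_eq_distr:
  "(lborel :: complex measure) = distr (lborel :: (real \<times> real) measure) borel (\<lambda>p. Complex (fst p) (snd p))"
proof (rule lborel_eqI)
  fix l u :: complex
  assume le: "\<And>b. b \<in> Basis \<Longrightarrow> l \<bullet> b \<le> u \<bullet> b"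
  have "(\<lambda>p. Complex (fst p) (snd p)) -` box l u \<inter> space lborel
        = {Re l<..<Re u} \<times> {Im l<..<Im u}"
    by (auto simp: in_box_complex_iff)
  moreover have "Re l \<le> Re u" "Im l \<le> Im u"
    using le[of 1] le[of \<i>] by (auto simp: Basis_complex_def)
  ultimately show "emeasure (distr (lborel :: (real \<times> real) measure) borel (\<lambda>p. Complex (fst p) (snd p))) (box l u)
      = ennreal (\<Prod>b\<in>Basis. (u - l) \<bullet> b)"
    by (simp add: emeasure_distr lborel_prod[symmetric] lborel.emeasure_pair_measure_Times
        Basis_complex_def inner_complex_def ennreal_mult)
qed simp

lemma nn_integral_lborel_complex:
  assumes [measurable]: "f \<in> borel_measurable borel"
  shows "(\<integral>\<^sup>+z. f z \<partial>(lborel :: complex measure)) = (\<integral>\<^sup>+u. \<integral>\<^sup>+v. f (Complex u v) \<partial>lborel \<partial>lborel)"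
proof -
  have [measurable]: "fst \<in> borel_measurable (borel :: (real \<times> real) measure)"
      "snd \<in> borel_measurable (borel :: (real \<times> real) measure)"
    by (auto intro!: borel_measurable_continuous_onI continuous_intros)
  have "(\<integral>\<^sup>+z. f z \<partial>(lborel :: complex measure))
      = (\<integral>\<^sup>+p. f (Complex (fst p) (snd p)) \<partial>(lborel :: (real \<times> real) measure))"
    by (subst lborel_complex_eq_distr, subst nn_integral_distr) simp_all
  also have "\<dots> = (\<integral>\<^sup>+u. \<integral>\<^sup>+v. f (Complex u v) \<partial>lborel \<partial>lborel)"
    by (subst lborel_prod[symmetric], subst lborel.nn_integral_fst[symmetric]) simp_all
  finally show ?thesis .
qed

lemma integral_lborel_complex:
  fixes f :: "complex \<Rightarrow> real"
  assumes f: "integrable lborel f"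
  shows "(\<integral>z. f z \<partial>lborel) = (\<integral>u. \<integral>v. f (Complex u v) \<partial>lborel \<partial>lborel)"
proof -
  have [measurable]: "f \<in> borel_measurable borel"
    using borel_measurable_integrable[OF f] by simp
  have [measurable]: "(\<lambda>p. Complex (fst p) (snd p)) \<in> borel_measurable (borel :: (real \<times> real) measure)"
    by (intro borel_measurable_continuous_onI) (auto intro!: continuous_intros simp: Complex_eq)
  have "integrable (lborel :: (real \<times> real) measure) (\<lambda>p. f (Complex (fst p) (snd p)))"
    using f by (subst (asm) lborel_complex_eq_distr) (simp add: integrable_distr_eq)
  then have "(\<integral>u. \<integral>v. f (Complex (fst (u, v)) (snd (u, v))) \<partial>lborel \<partial>lborel)
     = (\<integral>p. f (Complex (fst p) (snd p)) \<partial>(lborel :: (real \<times> real) measure))"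
    unfolding lborel_prod[symmetric] by (rule lborel_pair.integral_fst')
  also have "\<dots> = (\<integral>z. f z \<partial>lborel)"
  proof -
    have "(\<integral>z. f z \<partial>lborel) = (\<integral>z. f z \<partial>(distr (lborel :: (real \<times> real) measure) borel (\<lambda>p. Complex (fst p) (snd p))))"
      by (simp only: lborel_complex_eq_distr[symmetric])
    then show ?thesis by (simp add: integral_distr)
  qed
  finally show ?thesis by simp
qed

text \<open>The substitution v = tan t as an identity of measures: 1 / cos^2 is the derivative of
  tan, so on an interval the claim is the fundamental theorem of calculus between
  \<open>arctan l\<close> and \<open>arctan u\<close>.\<close>

lemma tan_distr_lborel:
  "distr (density lborel (\<lambda>t. ennreal (indicator {-(pi/2)<..<pi/2} t / (cos t)\<^sup>2))) borel
      (\<lambda>t. if t \<in> {-(pi/2)<..<pi/2} then tan t else 0) = (lborel :: real measure)"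
    (is "distr ?M borel ?f = _")
proof (rule lborel_eqI[symmetric])
  fix l u :: real
  assume "\<And>b. b \<in> Basis \<Longrightarrow> l \<bullet> b \<le> u \<bullet> b"
  then have le: "l \<le> u" by simp
  have sub: "- (pi/2) < arctan l" "arctan u < pi/2"
    using arctan_bounded by auto
  \<comment> \<open>Outside the branch \<open>?f\<close> has the filler value 0, which may lie in
    \<open>{l<..<u}\<close>, but the density vanishes there. The two excluded endpoints form a null
    set.\<close>
  have eq: "ennreal (indicator {-(pi/2)<..<pi/2} t / (cos t)\<^sup>2) * indicator (?f -` {l<..<u}) t
     = ennreal (indicator {arctan l..arctan u} t / (cos t)\<^sup>2) * indicator {arctan l..arctan u} t"
    if "t \<noteq> arctan l" "t \<noteq> arctan u" for t
  proof (cases "t \<in> {-(pi/2)<..<pi/2}")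
    case True
    then have "arctan (tan t) = t"
      by (simp add: arctan_tan)
    then have "tan t \<in> {l<..<u} \<longleftrightarrow> t \<in> {arctan l<..<arctan u}"
      by (metis arctan_less_iff greaterThanLessThan_iff)
    then show ?thesis using True that by (auto simp: indicator_def)
  next
    case False
    then have "t \<notin> {arctan l..arctan u}" using sub by auto
    then show ?thesis using False by (auto simp: indicator_def)
  qed
  have "emeasure (distr ?M borel ?f) {l<..<u}
      = (\<integral>\<^sup>+t. ennreal (indicator {-(pi/2)<..<pi/2} t / (cos t)\<^sup>2) * indicator (?f -` {l<..<u}) t \<partial>lborel)"
    using measurable_sets[OF borel_measurable_tan_restrict, of "{l<..<u}"]
    by (subst emeasure_distr) (simp_all add: emeasure_density del: greaterThanLessThan_iff)
  also have "\<dots> = (\<integral>\<^sup>+t. ennreal (indicator {arctan l..arctan u} t / (cos t)\<^sup>2) * indicator {arctan l..arctan u} t \<partial>lborel)"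
    by (intro nn_integral_cong_AE) (use AE_lborel_singleton[of "arctan l"] AE_lborel_singleton[of "arctan u"] in \<open>eventually_elim, use eq in blast\<close>)
  also have "\<dots> = (\<integral>\<^sup>+t. ennreal (1 / (cos t)\<^sup>2) * indicator {arctan l..arctan u} t \<partial>lborel)"
    by (intro nn_integral_cong) (auto simp: indicator_def)
  also have "\<dots> = ennreal (tan (arctan u) - tan (arctan l))"
  proof (rule nn_integral_FTC_Icc)
    fix x assume "x \<in> {arctan l..arctan u}"
    then have "cos x > 0" using sub by (intro cos_gt_zero_pi) auto
    then show "(tan has_real_derivative 1 / (cos x)\<^sup>2) (at x)"
      by (auto intro!: derivative_eq_intros simp: field_simps)
  qed (use le in \<open>auto simp: arctan_le_iff\<close>)
  finally show "emeasure (distr ?M borel ?f) (box l u) = ennreal (\<Prod>b\<in>Basis. (u - l) \<bullet> b)"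
    by (simp add: box_real tan_arctan)
qed simp

lemma nn_integral_tan_substitution:
  fixes f :: "real \<Rightarrow> ennreal"
  assumes [measurable]: "f \<in> borel_measurable borel"
  shows "(\<integral>\<^sup>+t. f t \<partial>lborel)
       = (\<integral>\<^sup>+\<theta>. ennreal (1 / (cos \<theta>)\<^sup>2) * f (tan \<theta>) * indicator {-(pi/2)<..<pi/2} \<theta> \<partial>lborel)"
proof -
  let ?f = "\<lambda>t. if t \<in> {-(pi/2)<..<pi/2} then tan t else (0::real)"
  show ?thesis
    by (subst tan_distr_lborel[symmetric], subst nn_integral_distr)
       (auto simp: nn_integral_density indicator_def simp del: greaterThanLessThan_iff intro!: nn_integral_cong)
qed

text \<open>Polar coordinates from three substitutions on the line: v = u t for fixed u > 0, then t
  = tan \<theta> after exchanging the integrals, then u = r cos \<theta> for fixed angle. The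
  Jacobians multiply to u * (1 / cos^2 \<theta>) * cos \<theta> = r.\<close>

lemma nn_integral_half_plane_polar:
  fixes f :: "complex \<Rightarrow> ennreal"
  assumes [measurable]: "f \<in> borel_measurable borel"
  shows "(\<integral>\<^sup>+z. f z * indicator {z. 0 < Re z} z \<partial>lborel)
     = (\<integral>\<^sup>+\<theta>. \<integral>\<^sup>+r. f (rcis r \<theta>) * ennreal r * indicator {0<..} r * indicator {-(pi/2)<..<pi/2} \<theta> \<partial>lborel \<partial>lborel)"
proof -
  have "(\<integral>\<^sup>+z. f z * indicator {z. 0 < Re z} z \<partial>lborel)
      = (\<integral>\<^sup>+u. \<integral>\<^sup>+v. f (Complex u v) * indicator {0<..} u \<partial>lborel \<partial>lborel)"
    by (subst nn_integral_lborel_complex) (auto simp: indicator_def intro!: nn_integral_cong)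
  also have "\<dots> = (\<integral>\<^sup>+u. \<integral>\<^sup>+t. f (Complex u (u * t)) * ennreal u * indicator {0<..} u \<partial>lborel \<partial>lborel)"
  proof (rule nn_integral_cong)
    fix u :: real
    show "(\<integral>\<^sup>+v. f (Complex u v) * indicator {0<..} u \<partial>lborel)
        = (\<integral>\<^sup>+t. f (Complex u (u * t)) * ennreal u * indicator {0<..} u \<partial>lborel)"
    proof (cases "u > 0")
      case True
      have "(\<integral>\<^sup>+v. f (Complex u v) \<partial>lborel) = ennreal \<bar>u\<bar> * (\<integral>\<^sup>+t. f (Complex u (0 + u * t)) \<partial>lborel)"
        using True by (intro nn_integral_real_affine) auto
      then show ?thesis
        using True by (simp add: nn_integral_cmult[symmetric] mult.commute)
    qed simp
  qed
  also have "\<dots> = (\<integral>\<^sup>+t. \<integral>\<^sup>+u. f (Complex u (u * t)) * ennreal u * indicator {0<..} u \<partial>lborel \<partial>lborel)"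
    by (rule lborel_pair.Fubini') auto
  also have "\<dots> = (\<integral>\<^sup>+\<theta>. ennreal (1 / (cos \<theta>)\<^sup>2) *
        (\<integral>\<^sup>+u. f (Complex u (u * tan \<theta>)) * ennreal u * indicator {0<..} u \<partial>lborel) * indicator {-(pi/2)<..<pi/2} \<theta> \<partial>lborel)"
    by (subst nn_integral_tan_substitution) auto
  also have "\<dots> = (\<integral>\<^sup>+\<theta>. \<integral>\<^sup>+r. f (rcis r \<theta>) * ennreal r * indicator {0<..} r * indicator {-(pi/2)<..<pi/2} \<theta> \<partial>lborel \<partial>lborel)"
  proof (rule nn_integral_cong)
    fix \<theta> :: real
    show "ennreal (1 / (cos \<theta>)\<^sup>2) *
        (\<integral>\<^sup>+u. f (Complex u (u * tan \<theta>)) * ennreal u * indicator {0<..} u \<partial>lborel) * indicator {-(pi/2)<..<pi/2} \<theta>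
      = (\<integral>\<^sup>+r. f (rcis r \<theta>) * ennreal r * indicator {0<..} r * indicator {-(pi/2)<..<pi/2} \<theta> \<partial>lborel)"
    proof (cases "\<theta> \<in> {-(pi/2)<..<pi/2}")
      case True
      then have c: "cos \<theta> > 0" by (intro cos_gt_zero_pi) auto
      have "(\<integral>\<^sup>+u. f (Complex u (u * tan \<theta>)) * ennreal u * indicator {0<..} u \<partial>lborel)
         = ennreal \<bar>cos \<theta>\<bar> * (\<integral>\<^sup>+r. f (Complex (0 + cos \<theta> * r) ((0 + cos \<theta> * r) * tan \<theta>)) * ennreal (0 + cos \<theta> * r) * indicator {0<..} (0 + cos \<theta> * r) \<partial>lborel)"
        using c by (intro nn_integral_real_affine) auto
      also have "\<dots> = (\<integral>\<^sup>+r. ennreal \<bar>cos \<theta>\<bar> * (f (Complex (0 + cos \<theta> * r) ((0 + cos \<theta> * r) * tan \<theta>)) * ennreal (0 + cos \<theta> * r) * indicator {0<..} (0 + cos \<theta> * r)) \<partial>lborel)"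
        by (subst nn_integral_cmult) auto
      finally have "ennreal (1 / (cos \<theta>)\<^sup>2) *
        (\<integral>\<^sup>+u. f (Complex u (u * tan \<theta>)) * ennreal u * indicator {0<..} u \<partial>lborel) =
         (\<integral>\<^sup>+r. ennreal (1 / (cos \<theta>)\<^sup>2) * (ennreal \<bar>cos \<theta>\<bar> * (f (Complex (0 + cos \<theta> * r) ((0 + cos \<theta> * r) * tan \<theta>)) * ennreal (0 + cos \<theta> * r) * indicator {0<..} (0 + cos \<theta> * r))) \<partial>lborel)"
        by (subst nn_integral_cmult) auto
      also have "\<dots> = (\<integral>\<^sup>+r. f (rcis r \<theta>) * ennreal r * indicator {0<..} r \<partial>lborel)"
      proof (rule nn_integral_cong)
        fix r :: real
        have 1: "Complex (0 + cos \<theta> * r) ((0 + cos \<theta> * r) * tan \<theta>) = rcis r \<theta>"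
          using c by (simp add: complex_eq_iff tan_def)
        have 2: "(0 < cos \<theta> * r) = (0 < r)" using c by (simp add: zero_less_mult_iff)
        have 3: "ennreal (1 / (cos \<theta>)\<^sup>2) * (ennreal \<bar>cos \<theta>\<bar> * ennreal (cos \<theta> * r)) = ennreal r" if "r > 0"
          using that c by (simp add: ennreal_mult[symmetric] power2_eq_square)
        show "ennreal (1 / (cos \<theta>)\<^sup>2) * (ennreal \<bar>cos \<theta>\<bar> * (f (Complex (0 + cos \<theta> * r) ((0 + cos \<theta> * r) * tan \<theta>)) * ennreal (0 + cos \<theta> * r) * indicator {0<..} (0 + cos \<theta> * r)))
          = f (rcis r \<theta>) * ennreal r * indicator {0<..} r"
          unfolding 1 using 2 3[symmetric] by (auto simp: indicator_def mult_ac)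
      qed
      finally show ?thesis using True by simp
    qed simp
  qed
  finally show ?thesis .
qed

section \<open>Folding the plane onto the right half plane\<close>

lemma AE_lborel_Re_neq_0: "AE z in (lborel :: complex measure). Re z \<noteq> 0"
proof -
  have "(\<integral>\<^sup>+z. indicator {z. Re z = 0} z \<partial>(lborel :: complex measure))
     = (\<integral>\<^sup>+u. \<integral>\<^sup>+v. indicator {0} u \<partial>(lborel :: real measure) \<partial>(lborel :: real measure))"
    by (subst nn_integral_lborel_complex) (auto intro!: nn_integral_cong simp: indicator_def)
  also have "\<dots> = (\<integral>\<^sup>+u. top * indicator {0} u \<partial>(lborel :: real measure))"
    by (simp add: mult.commute)
  also have "\<dots> = 0"
    by (subst nn_integral_cmult) auto
  finally show ?thesis
    by (intro AE_I[where N="{z. Re z = 0}"]) auto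
qed

lemma lborel_complex_uminus:
  "distr (lborel :: complex measure) borel uminus = lborel"
  using lborel_affine[of "-1" "0 :: complex"] by (simp add: density_1)

text \<open>The imaginary axis is a null set, and z -> -z preserves the measure and swaps the open
  half planes. This version yields finiteness bounds; its counterpart for real integrands yields
  values.\<close>

lemma nn_integral_lborel_complex_symmetrize:
  fixes f :: "complex \<Rightarrow> ennreal"
  assumes [measurable]: "f \<in> borel_measurable borel"
  shows "(\<integral>\<^sup>+z. f z \<partial>lborel) = (\<integral>\<^sup>+z. (f z + f (-z)) * indicator {z. 0 < Re z} z \<partial>lborel)"
proof -
  have "(\<integral>\<^sup>+z. f z \<partial>lborel)
      = (\<integral>\<^sup>+z. f z * indicator {z. 0 < Re z} z + f z * indicator {z. Re z < 0} z \<partial>lborel)"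
    by (intro nn_integral_cong_AE) (use AE_lborel_Re_neq_0 in \<open>eventually_elim, auto simp: indicator_def\<close>)
  also have "\<dots> = (\<integral>\<^sup>+z. f z * indicator {z. 0 < Re z} z \<partial>lborel) + (\<integral>\<^sup>+z. f z * indicator {z. Re z < 0} z \<partial>lborel)"
    by (subst nn_integral_add) auto
  also have "(\<integral>\<^sup>+z. f z * indicator {z. Re z < 0} z \<partial>lborel)
      = (\<integral>\<^sup>+z. f (-z) * indicator {z. 0 < Re z} z \<partial>lborel)"
    by (subst lborel_complex_uminus[symmetric], subst nn_integral_distr)
       (auto simp: indicator_def intro!: nn_integral_cong)
  finally show ?thesis
    by (simp add: nn_integral_add[symmetric] distrib_right)
qed

lemma integral_lborel_complex_symmetrize:
  fixes f :: "complex \<Rightarrow> real"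
  assumes f: "integrable lborel f"
  shows "integrable lborel (\<lambda>z. indicator {z. 0 < Re z} z * (f z + f (-z)))"
    and "(\<integral>z. f z \<partial>lborel) = (\<integral>z. indicator {z. 0 < Re z} z * (f z + f (-z)) \<partial>lborel)"
proof -
  note [measurable] = borel_measurable_integrable[OF f]
  have [measurable]: "f \<in> borel_measurable borel"
    using borel_measurable_integrable[OF f] by simp
  have f': "integrable lborel (\<lambda>z. f (-z))"
    using f by (subst (asm) lborel_complex_uminus[symmetric], subst (asm) integrable_distr_eq) auto
  have i1: "integrable lborel (\<lambda>z. indicator {z. 0 < Re z} z * f z)"
    and i2: "integrable lborel (\<lambda>z. indicator {z. Re z < 0} z * f z)"
    and i3: "integrable lborel (\<lambda>z. indicator {z. 0 < Re z} z * f (-z))"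
    by (auto intro!: integrable_real_mult_indicator f f' simp: mult.commute[of "indicator _ _ :: real"])
  show "integrable lborel (\<lambda>z. indicator {z. 0 < Re z} z * (f z + f (-z)))"
    using i1 i3 by (simp add: distrib_left)
  have "(\<integral>z. f z \<partial>lborel)
      = (\<integral>z. indicator {z. 0 < Re z} z * f z + indicator {z. Re z < 0} z * f z \<partial>lborel)"
    by (intro integral_cong_AE) (use AE_lborel_Re_neq_0 in \<open>auto simp: indicator_def elim: eventually_mono\<close>)
  also have "\<dots> = (\<integral>z. indicator {z. 0 < Re z} z * f z \<partial>lborel) + (\<integral>z. indicator {z. Re z < 0} z * f z \<partial>lborel)"
    using i1 i2 by simp
  also have "(\<integral>z. indicator {z. Re z < 0} z * f z \<partial>lborel)
      = (\<integral>z. indicator {z. 0 < Re z} z * f (-z) \<partial>lborel)"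
    by (subst lborel_complex_uminus[symmetric], subst integral_distr)
       (auto simp: indicator_def intro!: Bochner_Integration.integral_cong)
  finally show "(\<integral>z. f z \<partial>lborel) = (\<integral>z. indicator {z. 0 < Re z} z * (f z + f (-z)) \<partial>lborel)"
    using i1 i3 by (simp add: distrib_left)
qed

text \<open>Recasting the formula for nonnegative functions as an equality of measures lets
  integrability and values of signed integrands be transferred directly, without splitting them into
  positive and negative parts.\<close>

lemma density_half_plane_polar:
  "density (lborel :: complex measure) (indicator {z. 0 < Re z})
    = distr (density (lborel \<Otimes>\<^sub>M lborel)
        (\<lambda>p. ennreal (indicator {0<..} (fst p) * indicator {-(pi/2)<..<pi/2} (snd p) * fst p)))
        borel (\<lambda>p. rcis (fst p) (snd p))" (is "?L = distr (density _ ?d) _ _")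
proof (rule measure_eqI)
  fix A assume "A \<in> sets ?L"
  then have [measurable]: "A \<in> sets borel" by simp
  have "emeasure ?L A = (\<integral>\<^sup>+z. indicator A z * indicator {z. 0 < Re z} z \<partial>lborel)"
    by (simp add: emeasure_density mult.commute)
  also have "\<dots> = (\<integral>\<^sup>+\<theta>. \<integral>\<^sup>+r. indicator A (rcis r \<theta>) * ennreal r * indicator {0<..} r * indicator {-(pi/2)<..<pi/2} \<theta> \<partial>lborel \<partial>lborel)"
    by (rule nn_integral_half_plane_polar) simp
  also have "\<dots> = (\<integral>\<^sup>+p. ?d p * indicator A (rcis (fst p) (snd p)) \<partial>(lborel \<Otimes>\<^sub>M lborel))"
    by (subst lborel_pair.nn_integral_snd[symmetric])
       (auto simp: indicator_def intro!: nn_integral_cong)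
  also have "\<dots> = emeasure (distr (density (lborel \<Otimes>\<^sub>M lborel) ?d) borel (\<lambda>p. rcis (fst p) (snd p))) A"
  proof -
    have "emeasure (distr (density (lborel \<Otimes>\<^sub>M lborel) ?d) borel (\<lambda>p. rcis (fst p) (snd p))) A
        = emeasure (density (lborel \<Otimes>\<^sub>M lborel) ?d) ((\<lambda>p. rcis (fst p) (snd p)) -` A \<inter> space (lborel \<Otimes>\<^sub>M lborel))"
      by (subst emeasure_distr) auto
    also have "\<dots> = (\<integral>\<^sup>+p. ?d p * indicator ((\<lambda>p. rcis (fst p) (snd p)) -` A \<inter> space (lborel \<Otimes>\<^sub>M lborel)) p \<partial>(lborel \<Otimes>\<^sub>M lborel))"
      using measurable_sets[of "\<lambda>p. rcis (fst p) (snd p)" "lborel \<Otimes>\<^sub>M lborel" borel A]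
      by (subst emeasure_density) simp_all
    also have "\<dots> = (\<integral>\<^sup>+p. ?d p * indicator A (rcis (fst p) (snd p)) \<partial>(lborel \<Otimes>\<^sub>M lborel))"
      by (intro nn_integral_cong) (auto simp: indicator_def)
    finally show ?thesis by simp
  qed
  finally show "emeasure ?L A = emeasure (distr (density (lborel \<Otimes>\<^sub>M lborel) ?d) borel (\<lambda>p. rcis (fst p) (snd p))) A" .
qed simp

lemma
  fixes f :: "complex \<Rightarrow> real"
  assumes [measurable]: "f \<in> borel_measurable borel"
  shows integrable_half_plane_polar_iff:
      "integrable lborel (\<lambda>z. indicator {z. 0 < Re z} z * f z) \<longleftrightarrow> integrable (lborel \<Otimes>\<^sub>M lborel)
         (\<lambda>(r, \<theta>). indicator {0<..} r * r * (indicator {-(pi/2)<..<pi/2} \<theta> * f (rcis r \<theta>)))" (is ?int)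
    and integral_half_plane_polar_pair:
      "(\<integral>z. indicator {z. 0 < Re z} z * f z \<partial>lborel) = (\<integral>(r, \<theta>). indicator {0<..} r * r *
          (indicator {-(pi/2)<..<pi/2} \<theta> * f (rcis r \<theta>)) \<partial>(lborel \<Otimes>\<^sub>M lborel))" (is ?eq)
proof -
  let ?d = "\<lambda>p::real \<times> real. indicator {0<..} (fst p) * indicator {-(pi/2)<..<pi/2} (snd p) * fst p :: real"
  let ?M = "density (lborel \<Otimes>\<^sub>M lborel) (\<lambda>p. ennreal (?d p))"
  have d: "AE p in lborel \<Otimes>\<^sub>M lborel. 0 \<le> ?d p"
    by (auto simp: indicator_def)
  have i: "(\<lambda>p. ?d p *\<^sub>R f (rcis (fst p) (snd p)))
     = (\<lambda>(r, \<theta>). indicator {0<..} r * r * (indicator {-(pi/2)<..<pi/2} \<theta> * f (rcis r \<theta>)))"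
    by (auto simp: fun_eq_iff)
  have e: "density (lborel :: complex measure) (indicator {z. 0 < Re z})
      = density lborel (\<lambda>z. ennreal (indicator {z. 0 < Re z} z))"
    by (intro density_cong) (auto simp: indicator_def)
  have "integrable lborel (\<lambda>z. indicator {z. 0 < Re z} z *\<^sub>R f z)
      \<longleftrightarrow> integrable (density lborel (indicator {z. 0 < Re z})) f"
    unfolding e by (subst integrable_density) auto
  also have "\<dots> \<longleftrightarrow> integrable ?M (\<lambda>p. f (rcis (fst p) (snd p)))"
    unfolding density_half_plane_polar by (subst integrable_distr_eq) auto
  also have "\<dots> \<longleftrightarrow> integrable (lborel \<Otimes>\<^sub>M lborel) (\<lambda>p. ?d p *\<^sub>R f (rcis (fst p) (snd p)))"
    by (subst integrable_density[OF _ _ d]) auto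
  finally show ?int unfolding i by simp
  have "(\<integral>z. indicator {z. 0 < Re z} z *\<^sub>R f z \<partial>lborel)
      = integral\<^sup>L (density lborel (indicator {z. 0 < Re z})) f"
    unfolding e by (subst integral_density) auto
  also have "\<dots> = (\<integral>p. f (rcis (fst p) (snd p)) \<partial>?M)"
    unfolding density_half_plane_polar by (subst integral_distr) auto
  also have "\<dots> = (\<integral>p. ?d p *\<^sub>R f (rcis (fst p) (snd p)) \<partial>(lborel \<Otimes>\<^sub>M lborel))"
    by (subst integral_density[OF _ _ d]) auto
  finally show ?eq unfolding i by simp
qed

text \<open>Fubini with the angle innermost, the order in which circle averages become
  available.\<close>

lemma integral_half_plane_polar:
  fixes f :: "complex \<Rightarrow> real"
  assumes "f \<in> borel_measurable borel"
    and int: "integrable lborel (\<lambda>z. indicator {z. 0 < Re z} z * f z)"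
  shows "(\<integral>z. indicator {z. 0 < Re z} z * f z \<partial>lborel)
    = (\<integral>r. indicator {0<..} r * r * (\<integral>\<theta>. indicator {-(pi/2)<..<pi/2} \<theta> * f (rcis r \<theta>) \<partial>lborel) \<partial>lborel)"
proof -
  have "(\<integral>r. (\<integral>\<theta>. indicator {0<..} r * r * (indicator {-(pi/2)<..<pi/2} \<theta> * f (rcis r \<theta>)) \<partial>lborel) \<partial>lborel)
      = (\<integral>z. indicator {z. 0 < Re z} z * f z \<partial>lborel)"
    unfolding integral_half_plane_polar_pair[OF assms(1)]
    by (rule lborel_pair.integral_fst[OF int[unfolded integrable_half_plane_polar_iff[OF assms(1)]]])
  then show ?thesis by simp
qed

subsection \<open>Integrability of the logarithm\<close>

lemma sets_borel_cball [measurable]: "cball a r \<in> sets borel"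
  by (rule borel_closed) simp

text \<open>The Jacobian r cancels the singularity. Of the value, R is the radial length, pi the
  length of the angular range, and 2 comes from folding.\<close>

lemma nn_integral_inverse_cmod_cball:
  assumes R: "0 \<le> R"
  shows "(\<integral>\<^sup>+z. ennreal (indicator (cball 0 R) z / cmod z) \<partial>lborel) = ennreal (2 * pi * R)"
proof -
  let ?f = "\<lambda>z. ennreal (indicator (cball 0 R) z / cmod z)"
  have "(\<integral>\<^sup>+z. ?f z \<partial>lborel) = (\<integral>\<^sup>+z. (?f z + ?f (-z)) * indicator {z. 0 < Re z} z \<partial>lborel)"
    by (rule nn_integral_lborel_complex_symmetrize) auto
  also have "\<dots> = (\<integral>\<^sup>+\<theta>. \<integral>\<^sup>+r. (?f (rcis r \<theta>) + ?f (- rcis r \<theta>)) * ennreal r * indicator {0<..} r * indicator {-(pi/2)<..<pi/2} \<theta> \<partial>lborel \<partial>lborel)"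
    by (rule nn_integral_half_plane_polar) auto
  also have "\<dots> = (\<integral>\<^sup>+\<theta>. \<integral>\<^sup>+r. (2 * indicator {-(pi/2)<..<pi/2} \<theta>) * indicator {0<..R} r \<partial>lborel \<partial>(lborel :: real measure))"
  proof (rule nn_integral_cong, rule nn_integral_cong)
    fix \<theta> r :: real
    have "ennreal (1 / r) * ennreal r = 1" if "r > 0"
      using that by (simp add: ennreal_mult[symmetric])
    then show "(?f (rcis r \<theta>) + ?f (- rcis r \<theta>)) * ennreal r * indicator {0<..} r * indicator {-(pi/2)<..<pi/2} \<theta>
      = (2 * indicator {-(pi/2)<..<pi/2} \<theta>) * indicator {0<..R} r"
      by (auto simp: indicator_def distrib_right)
  qed
  also have "\<dots> = (\<integral>\<^sup>+\<theta>. (2 * ennreal R) * indicator {-(pi/2)<..<pi/2} \<theta> \<partial>(lborel :: real measure))"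
    using R by (subst nn_integral_cmult) (auto simp: mult_ac)
  also have "\<dots> = 2 * ennreal R * ennreal pi"
    by (subst nn_integral_cmult) auto
  also have "\<dots> = ennreal (2 * pi * R)"
    using R by (simp add: ennreal_mult[symmetric] mult_ac ennreal_numeral[symmetric] del: ennreal_numeral)
  finally show ?thesis .
qed

text \<open>Translation by a carries the unit disc into the disc of radius 1 + |a| around 0.\<close>

lemma nn_integral_inverse_cmod_add:
  "(\<integral>\<^sup>+z. ennreal (indicator (cball 0 1) z / cmod (z + a)) \<partial>lborel) \<le> ennreal (2 * pi * (1 + cmod a))"
proof -
  have "(\<integral>\<^sup>+z. ennreal (indicator (cball 0 1) z / cmod (z + a)) \<partial>lborel)
      \<le> (\<integral>\<^sup>+z. ennreal (indicator (cball 0 (1 + cmod a)) (a + z) / cmod (a + z)) \<partial>lborel)"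
  proof (rule nn_integral_mono, rule ennreal_leI)
    fix z
    have "cmod (a + z) \<le> cmod a + cmod z" by (rule norm_triangle_ineq)
    then show "indicator (cball 0 1) z / cmod (z + a) \<le> indicator (cball 0 (1 + cmod a)) (a + z) / cmod (a + z)"
      by (auto simp: indicator_def add.commute[of z])
  qed
  also have "\<dots> = (\<integral>\<^sup>+z. ennreal (indicator (cball 0 (1 + cmod a)) z / cmod z) \<partial>(distr lborel borel ((+) a)))"
    by (subst nn_integral_distr) auto
  also have "\<dots> = ennreal (2 * pi * (1 + cmod a))"
    unfolding lborel_distr_plus by (rule nn_integral_inverse_cmod_cball) simp
  finally show ?thesis .
qed

text \<open>A crude majorant suffices: s covers growth at infinity, and 1/s covers the singularity
  while staying locally integrable in the plane. At s = 0 it holds because \<open>ln 0\<close> and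
  \<open>1 / 0\<close> are both 0.\<close>

lemma abs_ln_le_add_inverse:
  fixes s :: real
  assumes "0 \<le> s"
  shows "\<bar>ln s\<bar> \<le> s + 1 / s"
proof (cases "s = 0")
  case False
  then have "0 < 1 / s" "ln s \<le> s - 1" "ln (1 / s) \<le> 1 / s - 1"
    using assms by (auto intro!: ln_le_minus_one simp del: ln_inverse)
  moreover have "ln (1 / s) = - ln s"
    using False assms by (simp add: ln_div)
  ultimately have "ln s \<le> s + 1 / s" "- ln s \<le> s + 1 / s"
    using assms by linarith+
  then show ?thesis by linarith
qed simp

lemma emeasure_lborel_cball_complex: "emeasure lborel (cball (0 :: complex) 1) = ennreal pi"
  by (subst emeasure_cball) (auto simp: unit_ball_vol_2)

text \<open>The explicit linear dependence on |a| matters: for the Cayley transform |a| <= 2 / |x +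
  1|, which can still be integrated over x. The constant is pi for the area of the disc plus 2 pi
  for the inverse modulus.\<close>

lemma nn_integral_ln_cmod_add:
  "(\<integral>\<^sup>+z. ennreal \<bar>indicator (cball 0 1) z * ln (cmod (z + a))\<bar> \<partial>lborel) \<le> ennreal (3 * pi * (1 + cmod a))"
proof -
  have "(\<integral>\<^sup>+z. ennreal \<bar>indicator (cball 0 1) z * ln (cmod (z + a))\<bar> \<partial>lborel)
    \<le> (\<integral>\<^sup>+z. ennreal (1 + cmod a) * indicator (cball 0 1) z + ennreal (indicator (cball 0 1) z / cmod (z + a)) \<partial>lborel)"
  proof (rule nn_integral_mono)
    fix z
    have "cmod (z + a) \<le> cmod z + cmod a" by (rule norm_triangle_ineq)
    then have "\<bar>ln (cmod (z + a))\<bar> \<le> 1 + cmod a + 1 / cmod (z + a)" if "cmod z \<le> 1"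
      using abs_ln_le_add_inverse[of "cmod (z + a)"] that by simp
    then show "ennreal \<bar>indicator (cball 0 1) z * ln (cmod (z + a))\<bar>
       \<le> ennreal (1 + cmod a) * indicator (cball 0 1) z + ennreal (indicator (cball 0 1) z / cmod (z + a))"
      by (auto simp: indicator_def ennreal_plus[symmetric] simp del: ennreal_plus intro!: ennreal_leI)
  qed
  also have "\<dots> = ennreal (1 + cmod a) * ennreal pi + (\<integral>\<^sup>+z. ennreal (indicator (cball 0 1) z / cmod (z + a)) \<partial>lborel)"
    by (subst nn_integral_add) (auto simp: nn_integral_cmult emeasure_lborel_cball_complex)
  also have "\<dots> \<le> ennreal (1 + cmod a) * ennreal pi + ennreal (2 * pi * (1 + cmod a))"
    by (intro add_left_mono nn_integral_inverse_cmod_add)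
  also have "\<dots> = ennreal (3 * pi * (1 + cmod a))"
    by (simp add: ennreal_mult[symmetric] ennreal_plus[symmetric] algebra_simps del: ennreal_plus)
  finally show ?thesis .
qed

lemma integrable_ln_cmod_add:
  "integrable lborel (\<lambda>z. indicator (cball 0 1) z * ln (cmod (z + a)))"
proof (rule integrableI_bounded)
  show "(\<integral>\<^sup>+z. ennreal (norm (indicator (cball 0 1) z * ln (cmod (z + a)))) \<partial>lborel) < \<infinity>"
    using nn_integral_ln_cmod_add[of a] by (auto simp: less_top[symmetric] top_unique)
qed simp

lemma cmod_cayley_le:
  assumes "cmod x \<le> 1"
  shows "cmod ((1 - x) / (1 + x)) \<le> 2 / cmod (x + 1)"
proof -
  have "cmod (1 - x) \<le> cmod 1 + cmod x" by (rule norm_triangle_ineq4)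
  then show ?thesis
    using assms by (auto simp: norm_divide add.commute intro!: divide_right_mono)
qed

text \<open>Joint integrability, as Fubini demands. By the linear bound on the inner integral, the
  pole at x = -1 contributes at most a multiple of 1 / |x + 1|.\<close>

lemma integrable_ln_cmod_cayley:
  "integrable (lborel \<Otimes>\<^sub>M lborel) (\<lambda>(x, y). indicator (cball 0 1) x *
      (indicator (cball 0 1) y * ln (cmod (y + (1 - x) / (1 + x)))))" (is "integrable _ ?f")
proof (rule integrableI_bounded)
  have meas[measurable]: "?f \<in> borel_measurable (lborel \<Otimes>\<^sub>M lborel)" by measurable
  show "?f \<in> borel_measurable (lborel \<Otimes>\<^sub>M lborel)" by fact
  have "(\<integral>\<^sup>+p. ennreal (norm (?f p)) \<partial>(lborel \<Otimes>\<^sub>M lborel))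
      = (\<integral>\<^sup>+x. \<integral>\<^sup>+y. ennreal (norm (?f (x, y))) \<partial>lborel \<partial>lborel)"
    by (subst lborel.nn_integral_fst) auto
  also have "\<dots> \<le> (\<integral>\<^sup>+x. ennreal (3 * pi) * indicator (cball 0 1) x + ennreal (6 * pi) * ennreal (indicator (cball 0 1) x / cmod (x + 1)) \<partial>lborel)"
  proof (rule nn_integral_mono)
    fix x :: complex
    let ?a = "(1 - x) / (1 + x)"
    show "(\<integral>\<^sup>+y. ennreal (norm (?f (x, y))) \<partial>lborel)
       \<le> ennreal (3 * pi) * indicator (cball 0 1) x + ennreal (6 * pi) * ennreal (indicator (cball 0 1) x / cmod (x + 1))"
    proof (cases "x \<in> cball 0 1")
      case True
      then have "(\<integral>\<^sup>+y. ennreal (norm (?f (x, y))) \<partial>lborel) \<le> ennreal (3 * pi * (1 + cmod ?a))"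
        using nn_integral_ln_cmod_add[of ?a] by simp
      also have "\<dots> \<le> ennreal (3 * pi * (1 + 2 / cmod (x + 1)))"
        using True cmod_cayley_le[of x] by (intro ennreal_leI mult_left_mono add_left_mono) auto
      also have "\<dots> = ennreal (3 * pi) * indicator (cball 0 1) x + ennreal (6 * pi) * ennreal (indicator (cball 0 1) x / cmod (x + 1))"
        using True by (simp add: ennreal_mult[symmetric] ennreal_plus[symmetric] algebra_simps del: ennreal_plus)
      finally show ?thesis .
    qed auto
  qed
  also have "\<dots> = ennreal (3 * pi) * ennreal pi + ennreal (6 * pi) * (\<integral>\<^sup>+x. ennreal (indicator (cball 0 1) x / cmod (x + 1)) \<partial>lborel)"
    by (subst nn_integral_add) (auto simp: nn_integral_cmult emeasure_lborel_cball_complex)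
  also have "\<dots> \<le> ennreal (3 * pi) * ennreal pi + ennreal (6 * pi) * ennreal (2 * pi * (1 + cmod 1))"
    by (intro add_left_mono mult_left_mono nn_integral_inverse_cmod_add) auto
  also have "\<dots> < \<infinity>"
    by (simp add: ennreal_mult[symmetric] ennreal_plus[symmetric] del: ennreal_plus)
  finally show "(\<integral>\<^sup>+p. ennreal (norm (?f p)) \<partial>(lborel \<Otimes>\<^sub>M lborel)) < \<infinity>" .
qed

subsection \<open>Jensen's formula for the disc\<close>

text \<open>Real part of the series of \<open>Ln (1 - z)\<close>; the sum may start at n = 0 because
  division by 0 gives 0.\<close>

lemma ln_cmod_one_minus_sums:
  assumes "cmod z < 1"
  shows "(\<lambda>n. - Re (z ^ n) / real n) sums ln (cmod (1 - z))"
proof -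
  have "(\<lambda>n. - ((-(-z)) ^ n) / of_nat n) sums Ln (1 + (-z))"
    using assms by (intro Ln_series') simp
  then have "(\<lambda>n. Re (- ((-(-z)) ^ n) / of_nat n)) sums Re (Ln (1 + (-z)))"
    by (rule sums_Re)
  moreover have "1 - z \<noteq> 0" using assms by auto
  moreover have "Re (- ((-(-z)) ^ n) / of_nat n) = - Re (z ^ n) / real n" for n
    by (cases "n = 0") (simp_all add: Re_divide_of_nat)
  ultimately show ?thesis by simp
qed

text \<open>Termwise integration, justified by the geometric majorant |w|^n. The frequency k is kept
  general: k = 2 serves Jensen's formula, k = 1 the half-circle averages.\<close>

lemma integral_ln_cmod_cis_sums:
  assumes w: "cmod w < 1"
  shows "(\<lambda>n. \<integral>t. indicator {a..b} t * (- Re ((w * cis (k * t)) ^ n) / real n) \<partial>lborel)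
     sums (\<integral>t. indicator {a..b} t * ln (cmod (1 - w * cis (k * t))) \<partial>lborel)"
proof -
  let ?f = "\<lambda>n t. indicator {a..b} t * (- Re ((w * cis (k * t)) ^ n) / real n)"
  have cont: "continuous_on {a..b} (\<lambda>t. - Re ((w * cis (k * t)) ^ n) / real n)" for n
    by (cases "n = 0") (auto intro!: continuous_intros)
  have int: "integrable lborel (?f n)" for n
    using borel_integrable_compact[OF _ cont, of n] by simp
  have bd: "norm (?f n t) \<le> indicator {a..b} t * cmod w ^ n" for n t
  proof -
    have "\<bar>Re ((w * cis (k * t)) ^ n)\<bar> \<le> cmod w ^ n"
      by (rule order_trans[OF abs_Re_le_cmod]) (simp add: norm_power norm_mult)
    moreover have "\<bar>Re ((w * cis (k * t)) ^ n)\<bar> / real n \<le> \<bar>Re ((w * cis (k * t)) ^ n)\<bar> / 1" if "n \<noteq> 0"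
      using that by (intro divide_left_mono) auto
    ultimately have "\<bar>Re ((w * cis (k * t)) ^ n)\<bar> / real n \<le> cmod w ^ n"
      by (cases "n = 0") auto
    then show ?thesis by (auto simp: indicator_def)
  qed
  have geo: "summable (\<lambda>n. cmod w ^ n)" using w by (intro summable_geometric) simp
  have "(\<lambda>n. integral\<^sup>L lborel (?f n)) sums (\<integral>t. (\<Sum>n. ?f n t) \<partial>lborel)"
  proof (rule sums_integral[OF int])
    show "AE t in lborel. summable (\<lambda>n. norm (?f n t))"
    proof (rule AE_I2)
      fix t
      show "summable (\<lambda>n. norm (?f n t))"
        by (rule summable_comparison_test'[where g="\<lambda>n. indicator {a..b} t * cmod w ^ n" and N=0])
           (use bd summable_mult[OF geo] in auto)
    qed
    show "summable (\<lambda>n. \<integral>t. norm (?f n t) \<partial>lborel)"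
    proof (rule summable_comparison_test'[where g="\<lambda>n. measure lborel {a..b} * cmod w ^ n" and N=0])
      show "summable (\<lambda>n. measure lborel {a..b} * cmod w ^ n)"
        by (rule summable_mult[OF geo])
      fix n
      have i: "integrable lborel (\<lambda>t. indicator {a..b} t * cmod w ^ n)"
        by (intro integrable_mult_left integrable_real_indicator) (auto simp: emeasure_lborel_Icc_eq)
      have "(\<integral>t. norm (?f n t) \<partial>lborel) \<le> (\<integral>t. indicator {a..b} t * cmod w ^ n \<partial>lborel)"
        by (rule integral_mono[OF integrable_norm[OF int] i bd])
      then show "norm (\<integral>t. norm (?f n t) \<partial>lborel) \<le> measure lborel {a..b} * cmod w ^ n"
        by simp
    qed
  qed
  moreover have "(\<Sum>n. ?f n t) = indicator {a..b} t * ln (cmod (1 - w * cis (k * t)))" for t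
    using w by (intro sums_unique[symmetric] sums_mult ln_cmod_one_minus_sums) (simp add: norm_mult)
  ultimately show ?thesis by simp
qed

lemma indicator_Ioo_Icc_AE:
  "AE t in (lborel :: real measure). indicator {a<..<b} t = (indicator {a..b} t :: real)"
  using AE_lborel_singleton[of a] AE_lborel_singleton[of b] by eventually_elim (auto simp: indicator_def)

text \<open>Im (w^n e^(inkt)) has derivative n k Re (w^n e^(inkt)). Integration thus adds a second
  factor 1/n to that of the logarithm series, which is how the argument 2 of the L-value
  arises.\<close>

lemma integral_Re_power_cis:
  assumes "a \<le> b" "k \<noteq> 0" "n \<noteq> 0"
  shows "(\<integral>t. indicator {a..b} t * (- Re ((w * cis (k * t)) ^ n) / real n) \<partial>lborel)
    = - Im (w ^ n * (cis (n * k * b) - cis (n * k * a))) / (k * (real n)\<^sup>2)"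
proof -
  have eq: "- Re ((w * cis (k * t)) ^ n) / real n
     = - (Re (w ^ n) * cos (n * k * t) - Im (w ^ n) * sin (n * k * t)) / real n" for t
    by (simp add: power_mult_distrib Complex.DeMoivre mult_ac)
  have "(\<integral>t. (- (Re (w ^ n) * cos (n * k * t) - Im (w ^ n) * sin (n * k * t)) / real n) * indicator {a..b} t \<partial>lborel)
     = (- Im (w ^ n * cis (n * k * b)) / (k * (real n)\<^sup>2)) - (- Im (w ^ n * cis (n * k * a)) / (k * (real n)\<^sup>2))"
    by (rule integral_FTC_Icc_real[OF assms(1)])
       (use assms in \<open>auto intro!: derivative_eq_intros simp: field_simps power2_eq_square\<close>)
  moreover have "(- Im (w ^ n * cis (n * k * b)) / (k * (real n)\<^sup>2)) - (- Im (w ^ n * cis (n * k * a)) / (k * (real n)\<^sup>2))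
     = - Im (w ^ n * (cis (n * k * b) - cis (n * k * a))) / (k * (real n)\<^sup>2)"
  proof -
    have "- x / d - (- y / d) = - (x - y) / d" for x y d :: real
      by (simp add: diff_divide_distrib)
    then show ?thesis
      by (simp only: right_diff_distrib minus_complex.simps)
  qed
  ultimately show ?thesis
    unfolding eq by (simp add: mult.commute)
qed

text \<open>The half circle is a full period of \<open>cis (2 * t)\<close>, so every term of the
  series integrates to 0: the mean value property of a harmonic function vanishing at the
  centre.\<close>

lemma integral_ln_cmod_one_minus_cis_double:
  assumes "cmod w < 1"
  shows "(\<integral>t. indicator {-(pi/2)..pi/2} t * ln (cmod (1 - w * cis (2 * t))) \<partial>lborel) = 0"
proof -
  have eq: "(\<integral>t. indicator {-(pi/2)..pi/2} t * (- Re ((w * cis (2 * t)) ^ n) / real n) \<partial>lborel) = 0" for n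
  proof (cases "n = 0")
    case False
    have "cis (real n * 2 * (pi/2)) = cis (real n * 2 * (-(pi/2)))"
      by (simp add: complex_eq_iff)
    then show ?thesis using False by (subst integral_Re_power_cis) auto
  qed simp
  have "(\<lambda>n. 0) sums (\<integral>t. indicator {-(pi/2)..pi/2} t * ln (cmod (1 - w * cis (2 * t))) \<partial>lborel)"
    using integral_ln_cmod_cis_sums[OF assms, of "-(pi/2)" "pi/2" 2] unfolding eq .
  then show ?thesis using sums_unique2 sums_zero by blast
qed

lemma integrable_ln_cmod_cis:
  assumes "cmod w < 1"
  shows "integrable lborel (\<lambda>t. indicator {a..b} t * ln (cmod (1 - w * cis (k * t))))"
proof -
  have "1 - w * cis (k * t) \<noteq> 0" for t
  proof
    assume "1 - w * cis (k * t) = 0"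
    then have "cmod (w * cis (k * t)) = 1" by (metis eq_iff_diff_eq_0 norm_one)
    then show False using assms by (simp add: norm_mult)
  qed
  then have "continuous_on {a..b} (\<lambda>t. ln (cmod (1 - w * cis (k * t))))"
    by (intro continuous_intros) auto
  from borel_integrable_compact[OF _ this] show ?thesis by simp
qed

text \<open>Jensen's formula in folded form. Pulling out the larger of |a|^2 and r^2 leaves |1 - w
  e^(2it)| with |w| < 1, whose logarithm has mean 0; what remains is ln (max^2) times the length
  pi.\<close>

lemma integral_ln_cmod_power2_minus:
  assumes "0 < r" "r \<noteq> cmod a" "a \<noteq> 0"
  shows "(\<integral>t. indicator {-(pi/2)..pi/2} t * ln (cmod (a\<^sup>2 - (of_real r)\<^sup>2 * cis (2 * t))) \<partial>lborel)
    = 2 * pi * ln (max r (cmod a))"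
proof -
  have main: ?thesis
    if w: "cmod w < 1" and s: "s = max r (cmod a)"
      and eq: "\<And>t. cmod (a\<^sup>2 - (of_real r)\<^sup>2 * cis (2 * t)) = s\<^sup>2 * cmod (1 - w * cis (2 * t))" for w s
  proof -
    have s0: "s > 0" using s assms by auto
    have ne: "1 - w * cis (2 * t) \<noteq> 0" for t
    proof
      assume "1 - w * cis (2 * t) = 0"
      then have "cmod (w * cis (2 * t)) = 1" by (metis eq_iff_diff_eq_0 norm_one)
      then show False using w by (simp add: norm_mult)
    qed
    have "indicator {-(pi/2)..pi/2} t * ln (cmod (a\<^sup>2 - (of_real r)\<^sup>2 * cis (2 * t)))
       = indicator {-(pi/2)..pi/2} t * (2 * ln s) + indicator {-(pi/2)..pi/2} t * ln (cmod (1 - w * cis (2 * t)))" for t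
      unfolding eq using ne[of t] s0 by (simp add: ln_mult ln_realpow distrib_left)
    then show ?thesis
      using integral_ln_cmod_one_minus_cis_double[OF w] integrable_ln_cmod_cis[OF w, of "-(pi/2)" "pi/2" 2]
      by (simp add: s)
  qed
  show ?thesis
  proof (cases "r < cmod a")
    case True
    have "a\<^sup>2 - (of_real r)\<^sup>2 * cis (2 * t) = a\<^sup>2 * (1 - (of_real r / a)\<^sup>2 * cis (2 * t))" for t
      using assms by (simp add: field_simps power2_eq_square)
    then have "cmod (a\<^sup>2 - (of_real r)\<^sup>2 * cis (2 * t)) = (cmod a)\<^sup>2 * cmod (1 - (of_real r / a)\<^sup>2 * cis (2 * t))" for t
      by (simp only: norm_mult norm_power)
    moreover have "cmod ((of_real r / a)\<^sup>2) < 1"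
      using True assms by (simp add: norm_power norm_divide power_less_one_iff abs_square_less_1)
    ultimately show ?thesis using True by (intro main) auto
  next
    case False
    then have "cmod ((cnj a / of_real r)\<^sup>2) < 1"
      using assms by (simp add: norm_power norm_divide abs_square_less_1)
    moreover have "cmod (a\<^sup>2 - (of_real r)\<^sup>2 * cis (2 * t)) = r\<^sup>2 * cmod (1 - (cnj a / of_real r)\<^sup>2 * cis (2 * t))" for t
    proof -
      \<comment> \<open>Pulling out r^2 e^(2it) leaves 1 - (a/r)^2 e^(-2it). Conjugation restores
        the positive frequency without changing the modulus, at the price of \<open>cnj a\<close> in
        w.\<close>
      have "a\<^sup>2 - (of_real r)\<^sup>2 * cis (2 * t) = - ((of_real r)\<^sup>2 * cis (2 * t)) * cnj (1 - (cnj a / of_real r)\<^sup>2 * cis (2 * t))"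
        using assms by (simp add: field_simps power2_eq_square cis_cnj cis_mult)
      then have "cmod (a\<^sup>2 - (of_real r)\<^sup>2 * cis (2 * t)) = cmod ((of_real r)\<^sup>2 * cis (2 * t)) * cmod (1 - (cnj a / of_real r)\<^sup>2 * cis (2 * t))"
        by (simp only: norm_mult norm_minus_cancel complex_mod_cnj)
      then show ?thesis by (simp add: norm_mult norm_power)
    qed
    ultimately show ?thesis using False by (intro main) auto
  qed
qed

text \<open>Origin of the two branches of the disc average. For c < 1 the interval splits at r = c,
  and the c^2 ln c terms of the two pieces cancel.\<close>

lemma integral_r_ln_max:
  fixes c :: real
  assumes "0 < c"
  shows "(\<integral>r. indicator {0<..1} r * (r * ln (max r c)) \<partial>lborel)
     = (if 1 \<le> c then ln c / 2 else (c\<^sup>2 - 1) / 4)"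
proof (cases "1 \<le> c")
  case True
  have "(\<integral>r. indicator {0<..1} r * (r * ln (max r c)) \<partial>lborel) = (\<integral>r. (r * ln c) * indicator {0..1} r \<partial>lborel)"
  proof (rule Bochner_Integration.integral_cong)
    fix r :: real
    show "indicator {0<..1} r * (r * ln (max r c)) = (r * ln c) * indicator {0..1} r"
      using True by (cases "r = 0") (auto simp: indicator_def max_absorb2)
  qed simp
  also have "\<dots> = 1\<^sup>2 / 2 * ln c - 0\<^sup>2 / 2 * ln c"
    by (rule integral_FTC_Icc_real) (auto intro!: derivative_eq_intros)
  finally show ?thesis using True by simp
next
  case False
  have *: "has_bochner_integral lborel (\<lambda>r. (r * ln c) * indicator {0..c} r) (c\<^sup>2 / 2 * ln c - 0\<^sup>2 / 2 * ln c)"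
    by (rule has_bochner_integral_FTC_Icc_real) (use assms in \<open>auto intro!: derivative_eq_intros\<close>)
  have **: "has_bochner_integral lborel (\<lambda>r. (r * ln r) * indicator {c..1} r)
       ((1\<^sup>2 / 2 * ln 1 - 1\<^sup>2 / 4) - (c\<^sup>2 / 2 * ln c - c\<^sup>2 / 4))"
    by (rule has_bochner_integral_FTC_Icc_real)
       (use assms False in \<open>auto intro!: derivative_eq_intros continuous_intros simp: field_simps power2_eq_square\<close>)
  have "(\<integral>r. indicator {0<..1} r * (r * ln (max r c)) \<partial>lborel)
      = (\<integral>r. (r * ln c) * indicator {0..c} r + (r * ln r) * indicator {c..1} r \<partial>lborel)"
    by (intro integral_cong_AE)
       (use False assms AE_lborel_singleton[of c] in \<open>auto simp: indicator_def max_def elim!: eventually_mono\<close>)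
  also have "\<dots> = (c\<^sup>2 / 2 * ln c - 0\<^sup>2 / 2 * ln c) + ((1\<^sup>2 / 2 * ln 1 - 1\<^sup>2 / 4) - (c\<^sup>2 / 2 * ln c - c\<^sup>2 / 4))"
    using has_bochner_integral_add[OF * **] by (rule has_bochner_integral_integral_eq)
  finally show ?thesis using False by (simp add: field_simps)
qed

text \<open>After folding, the integrand on the circle of radius r is ln |a^2 - r^2 e^(2it)|. The
  one radius r = |a|, where the circle meets a zero, is negligible.\<close>

lemma integral_cball_ln_cmod_add:
  assumes a: "a \<noteq> 0"
  shows "(\<integral>z. indicator (cball 0 1) z * ln (cmod (z + a)) \<partial>lborel)
     = pi * (if 1 \<le> cmod a then ln (cmod a) else ((cmod a)\<^sup>2 - 1) / 2)"
proof -
  let ?f = "\<lambda>z. indicator (cball 0 1) z * ln (cmod (z + a))"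
  let ?g = "\<lambda>z. ?f z + ?f (-z)"
  note sym = integral_lborel_complex_symmetrize[OF integrable_ln_cmod_add[of a]]
  have "(\<integral>z. ?f z \<partial>lborel) = (\<integral>z. indicator {z. 0 < Re z} z * ?g z \<partial>lborel)"
    by (rule sym(2))
  also have "\<dots> = (\<integral>r. indicator {0<..} r * r * (\<integral>\<theta>. indicator {-(pi/2)<..<pi/2} \<theta> * ?g (rcis r \<theta>) \<partial>lborel) \<partial>lborel)"
    by (rule integral_half_plane_polar[OF _ sym(1)]) measurable
  also have "\<dots> = (\<integral>r. 2 * pi * (indicator {0<..1} r * (r * ln (max r (cmod a)))) \<partial>lborel)"
  proof (rule integral_cong_AE)
    show "AE r in lborel. indicator {0<..} r * r * (\<integral>\<theta>. indicator {-(pi/2)<..<pi/2} \<theta> * ?g (rcis r \<theta>) \<partial>lborel)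
      = 2 * pi * (indicator {0<..1} r * (r * ln (max r (cmod a))))"
      using AE_lborel_singleton[of "cmod a"]
    proof eventually_elim
      case (elim r)
      show ?case
      proof (cases "r \<in> {0<..1}")
        case True
        have "?g (rcis r \<theta>) = ln (cmod (a\<^sup>2 - (of_real r)\<^sup>2 * cis (2 * \<theta>)))" for \<theta>
        proof -
          have "cmod (rcis r \<theta>) \<noteq> cmod a" using elim True by simp
          then have "rcis r \<theta> + a \<noteq> 0" "- rcis r \<theta> + a \<noteq> 0"
            by (metis add_eq_0_iff norm_minus_cancel)+
          moreover have "a\<^sup>2 - (of_real r)\<^sup>2 * cis (2 * \<theta>) = (rcis r \<theta> + a) * (- rcis r \<theta> + a)"
            by (simp add: rcis_def algebra_simps power2_eq_square cis_mult)
          ultimately show ?thesis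
            using True by (simp add: norm_mult ln_mult)
        qed
        then have "(\<integral>\<theta>. indicator {-(pi/2)<..<pi/2} \<theta> * ?g (rcis r \<theta>) \<partial>lborel)
           = (\<integral>\<theta>. indicator {-(pi/2)..pi/2} \<theta> * ln (cmod (a\<^sup>2 - (of_real r)\<^sup>2 * cis (2 * \<theta>))) \<partial>lborel)"
          by (intro integral_cong_AE)
             (use indicator_Ioo_Icc_AE[of "-(pi/2)" "pi/2"] in \<open>auto elim!: eventually_mono\<close>)
        also have "\<dots> = 2 * pi * ln (max r (cmod a))"
          using elim True a by (intro integral_ln_cmod_power2_minus) auto
        finally show ?thesis using True by simp
      qed auto
    qed
  qed measurable
  also have "\<dots> = pi * (if 1 \<le> cmod a then ln (cmod a) else ((cmod a)\<^sup>2 - 1) / 2)"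
    using a by (simp add: integral_r_ln_max)
  finally show ?thesis .
qed

subsection \<open>Series for the character of conductor 4\<close>

text \<open>The form in which the character appears below: the imaginary part of
  \<open>cis (n * t)\<close> at the endpoint t = pi/2 of the right half circle.\<close>

lemma chi_m4_eq_sin: "chi_m4 n = sin (real n * (pi / 2))"
proof -
  have "real n = real (n mod 4) + 4 * real (n div 4)"
    by (metis mod_mult_div_eq of_nat_add of_nat_mult of_nat_numeral)
  then have "sin (real n * (pi / 2)) = sin (real (n mod 4) * (pi / 2) + 2 * real (n div 4) * pi)"
    by (simp add: algebra_simps)
  also have "\<dots> = sin (real (n mod 4) * (pi / 2))"
    by (simp only: sin_add sin_2npi cos_2npi mult_1_right mult_zero_right add_0_right)
  finally have "sin (real n * (pi / 2)) = sin (real (n mod 4) * (pi / 2))" .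
  moreover have "sin (3 * pi / 2) = - 1" using sin_3over2_pi by simp
  moreover consider "n mod 4 = 0" | "n mod 4 = 1" | "n mod 4 = 2" | "n mod 4 = 3" by linarith
  then have "sin (real (n mod 4) * (pi / 2)) = chi_m4 n"
    using \<open>sin (3 * pi / 2) = - 1\<close> by cases (simp_all add: chi_m4_def)
  ultimately show ?thesis by (simp only:)
qed

lemma chi_m4_even: "even n \<Longrightarrow> chi_m4 n = 0"
  by (auto simp: chi_m4_def) presburger+

lemma abs_chi_m4_le: "\<bar>chi_m4 n\<bar> \<le> 1"
  by (simp add: chi_m4_def)

lemma chi_m4_add_2: "chi_m4 (n + 2) = - chi_m4 n"
  by (simp add: chi_m4_eq_sin sin_add distrib_right add_divide_distrib)

lemma summable_inverse_squares_nat: "summable (\<lambda>n. 1 / (real n)\<^sup>2)"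
  using inverse_power_summable[of 2, where 'a=real] by (simp add: inverse_eq_divide)

text \<open>Restarts the sum at n = 0, where the term is 0, to match the indexing of the logarithm
  series.\<close>

lemma L_chi_m4_2_sums: "(\<lambda>n. chi_m4 n / (real n)\<^sup>2) sums L_chi_m4 2"
proof -
  have "summable (\<lambda>n. chi_m4 n / (real n)\<^sup>2)"
    by (rule summable_comparison_test'[OF summable_inverse_squares_nat, of 0])
       (auto simp: abs_divide abs_chi_m4_le divide_right_mono)
  then have "(\<lambda>n. chi_m4 (Suc n) / (real (Suc n))\<^sup>2) sums (\<Sum>n. chi_m4 (Suc n) / (real (Suc n))\<^sup>2)"
    by (subst (asm) summable_Suc_iff[symmetric]) (rule summable_sums)
  moreover have "(\<Sum>n. chi_m4 (Suc n) / (real (Suc n))\<^sup>2) = L_chi_m4 2"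
    unfolding L_chi_m4_def by (simp add: powr_numeral)
  ultimately have "(\<lambda>n. chi_m4 (Suc n) / (real (Suc n))\<^sup>2) sums L_chi_m4 2" by simp
  from sums_Suc[OF this] show ?thesis by simp
qed

text \<open>The Leibniz series for arctan 1 with zeros inserted at even indices. Convergence is only
  conditional, so the reindexing has to be order preserving.\<close>

lemma chi_m4_div_sums: "(\<lambda>n. chi_m4 n / real n) sums (pi / 4)"
proof -
  have "(\<lambda>k. (-1) ^ k * (1 / real (k * 2 + 1) * 1 ^ (k * 2 + 1))) sums arctan 1"
    using summable_arctan_series[of 1]
    by (subst arctan_series) (auto intro!: summable_sums simp del: mult_1_right)
  then have "(\<lambda>k. (-1) ^ k / real (2 * k + 1)) sums (pi / 4)"
    by (simp add: arctan_one mult.commute)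
  moreover have "(\<lambda>k. (-1) ^ k / real (2 * k + 1)) = (\<lambda>k. chi_m4 (2 * k + 1) / real (2 * k + 1))"
  proof
    fix k
    have "chi_m4 (2 * k + 1) = (-1) ^ k"
    proof (induction k)
      case (Suc k)
      have "chi_m4 (2 * Suc k + 1) = chi_m4 ((2 * k + 1) + 2)" by simp
      then show ?case using Suc by (simp only: chi_m4_add_2) simp
    qed (simp add: chi_m4_def)
    then show "(-1) ^ k / real (2 * k + 1) = chi_m4 (2 * k + 1) / real (2 * k + 1)" by simp
  qed
  ultimately have sums: "(\<lambda>k. chi_m4 (2 * k + 1) / real (2 * k + 1)) sums (pi / 4)" by simp
  have mono: "strict_mono (\<lambda>k::nat. 2 * k + 1)" by (auto intro: strict_monoI)
  have zero: "chi_m4 n / real n = 0" if "n \<notin> range (\<lambda>k::nat. 2 * k + 1)" for n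
  proof -
    have "even n"
    proof (rule ccontr)
      assume "odd n"
      then obtain k where "n = 2 * k + 1" by (rule oddE)
      then show False using that by blast
    qed
    then show ?thesis by (simp add: chi_m4_even)
  qed
  have "(\<lambda>k. chi_m4 (2 * k + 1) / real (2 * k + 1)) sums (pi / 4) \<longleftrightarrow> (\<lambda>n. chi_m4 n / real n) sums (pi / 4)"
    by (rule sums_mono_reindex[where g="\<lambda>k. 2 * k + 1" and f="\<lambda>n. chi_m4 n / real n"]) (fact mono, fact zero)
  then show ?thesis using sums by (rule iffD1)
qed

text \<open>As the character changes sign under n -> n + 2, this is minus the tail of the Leibniz
  series from n = 2 on; the terms left out add up to 1.\<close>

lemma chi_m4_div_add_2_sums: "(\<lambda>n. chi_m4 n / (real n + 2)) sums (1 - pi / 4)"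
proof -
  have "(\<Sum>i<2. chi_m4 i / real i) = 1"
    by (simp add: numeral_2_eq_2 chi_m4_def)
  then have "(\<lambda>n. chi_m4 (n + 2) / real (n + 2)) sums (pi / 4 - 1)"
    using chi_m4_div_sums by (subst sums_iff_shift) simp
  from sums_minus[OF this] show ?thesis
    unfolding chi_m4_add_2 by (simp add: add.commute[of 2])
qed

text \<open>Partial fractions: 1 / (n^2 (n + 2)) = 1 / (2 n^2) - 1 / (4 n) + 1 / (4 (n + 2)). The
  factor n + 2 will come from the radial integral of r^(n + 1).\<close>

lemma chi_m4_cubic_sums:
  "(\<lambda>n. chi_m4 n / ((real n)\<^sup>2 * (real n + 2))) sums (L_chi_m4 2 / 2 - pi / 8 + 1 / 4)"
proof -
  have eq: "chi_m4 n / ((real n)\<^sup>2 * (real n + 2))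
     = (1/2) * (chi_m4 n / (real n)\<^sup>2) - (1/4) * (chi_m4 n / real n) + (1/4) * (chi_m4 n / (real n + 2))" for n
  proof (cases "n = 0")
    case False
    have "c / (x\<^sup>2 * y) = (1/2) * (c / x\<^sup>2) - (1/4) * (c / x) + (1/4) * (c / y)"
      if "x \<noteq> 0" "y \<noteq> 0" "y = x + 2" for c x y :: real
    proof -
      have "c / x\<^sup>2 = c * y / (x\<^sup>2 * y)" "c / x = c * x * y / (x\<^sup>2 * y)" "c / y = c * x\<^sup>2 / (x\<^sup>2 * y)"
        using that(1,2) by (simp_all add: power2_eq_square)
      moreover have "4 * (c / (x\<^sup>2 * y)) = (c * y + c * y - c * x * y + c * x\<^sup>2) / (x\<^sup>2 * y)"
        by (simp add: that(3) algebra_simps power2_eq_square)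
      moreover have "4 * p = q + q - r + t \<Longrightarrow> p = (1/2) * q - (1/4) * r + (1/4) * t" for p q r t :: real
        by linarith
      ultimately show ?thesis
        by (simp only: add_divide_distrib diff_divide_distrib)
    qed
    then show ?thesis using False by simp
  qed (simp add: chi_m4_def)
  have S: "(\<lambda>n. (1/2) * (chi_m4 n / (real n)\<^sup>2) - (1/4) * (chi_m4 n / real n) + (1/4) * (chi_m4 n / (real n + 2)))
      sums ((1/2) * L_chi_m4 2 - (1/4) * (pi / 4) + (1/4) * (1 - pi / 4))"
    by (intro sums_add sums_diff sums_mult L_chi_m4_2_sums chi_m4_div_sums chi_m4_div_add_2_sums)
  have val: "(1/2) * L_chi_m4 2 - (1/4) * (pi / 4) + (1/4) * (1 - pi / 4) = L_chi_m4 2 / 2 - pi / 8 + 1 / 4"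
    by (simp add: algebra_simps)
  show ?thesis
    using S by (simp only: val eq)
qed

text \<open>The character enters here: the integral of e^(int) over the right half circle is 2 sin
  (n pi / 2) / n.\<close>

lemma integral_ln_cmod_half_circle_sums:
  assumes "\<bar>r\<bar> < 1"
  shows "(\<lambda>n. 2 * (chi_m4 n / (real n)\<^sup>2 * r ^ n))
     sums (\<integral>t. indicator {-(pi/2)..pi/2} t * ln (cmod (1 + of_real r * cis t)) \<partial>lborel)"
proof -
  have eq: "(\<integral>t. indicator {-(pi/2)..pi/2} t * (- Re ((of_real (- r) * cis (1 * t)) ^ n) / real n) \<partial>lborel)
     = 2 * (chi_m4 n / (real n)\<^sup>2 * r ^ n)" for n
  proof (cases "n = 0")
    case False
    have im: "Im (of_real (- r) ^ n * (cis (real n * 1 * (pi/2)) - cis (real n * 1 * (-(pi/2)))))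
       = 2 * ((- r) ^ n * chi_m4 n)"
      unfolding of_real_power[symmetric] chi_m4_eq_sin by simp
    \<comment> \<open>For odd n the sign of (-r)^n absorbs the minus of the logarithm series; for
      even n the character vanishes.\<close>
    have sgn: "(- r) ^ n * chi_m4 n = - (r ^ n * chi_m4 n)"
      by (cases "even n") (auto simp: chi_m4_even)
    have "(\<integral>t. indicator {-(pi/2)..pi/2} t * (- Re ((of_real (- r) * cis (1 * t)) ^ n) / real n) \<partial>lborel)
       = - Im (of_real (- r) ^ n * (cis (real n * 1 * (pi/2)) - cis (real n * 1 * (-(pi/2))))) / (1 * (real n)\<^sup>2)"
      using False by (intro integral_Re_power_cis) auto
    also have "\<dots> = 2 * (chi_m4 n / (real n)\<^sup>2 * r ^ n)"
      unfolding im sgn by simp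
    finally show ?thesis .
  qed (simp add: chi_m4_def)
  show ?thesis
    using integral_ln_cmod_cis_sums[of "of_real (- r)" "-(pi/2)" "pi/2" 1] assms
    unfolding eq by simp
qed

subsection \<open>The two integrals over the half disc\<close>

text \<open>The half-circle series at r and at -r are subtracted and integrated radially term by
  term. The terms are dominated by 4 / n^2 uniformly for r in [0, 1], so no separate limit r -> 1 is
  needed; the circle r = 1 is a null set.\<close>

lemma integral_cball_ln_cmod_diff:
  "integrable lborel (\<lambda>z. indicator {z. 0 < Re z} z * (indicator (cball 0 1) z * (ln (cmod (1 + z)) - ln (cmod (1 - z)))))"
  "(\<integral>z. indicator {z. 0 < Re z} z * (indicator (cball 0 1) z * (ln (cmod (1 + z)) - ln (cmod (1 - z)))) \<partial>lborel)
    = 2 * L_chi_m4 2 - pi / 2 + 1"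
proof -
  let ?f = "\<lambda>z. indicator (cball 0 1) z * (ln (cmod (1 + z)) - ln (cmod (1 - z))) :: real"
  let ?X = "\<lambda>n. chi_m4 n / (real n)\<^sup>2"
  have "integrable lborel (\<lambda>z. indicator (cball 0 1) z * ln (cmod (z + 1)) - indicator (cball 0 1) z * ln (cmod (z + (-1))))"
    by (intro Bochner_Integration.integrable_diff integrable_ln_cmod_add)
  moreover have "(\<lambda>z. indicator (cball 0 1) z * ln (cmod (z + 1)) - indicator (cball 0 1) z * ln (cmod (z + (-1)))) = ?f"
    by (auto simp: fun_eq_iff right_diff_distrib add.commute norm_minus_commute)
  ultimately have "integrable lborel ?f" by simp
  from integrable_real_mult_indicator[OF _ this, of "{z. 0 < Re z}"]
  show int: "integrable lborel (\<lambda>z. indicator {z. 0 < Re z} z * ?f z)"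
    by (simp add: mult.commute)
  \<comment> \<open>Only odd n survive, and there the two series reinforce each other to 4; the
    extra power of r is the Jacobian.\<close>
  let ?h = "\<lambda>n r. (4 * ?X n) * (r ^ (n + 1) * indicator {0..1} r)"
  have inner: "(\<lambda>n. ?h n r) sums (r * (\<integral>\<theta>. indicator {-(pi/2)<..<pi/2} \<theta> * ?f (rcis r \<theta>) \<partial>lborel))"
    if r: "0 < r" "r < 1" for r
  proof -
    have "cmod (of_real (-r)) < 1" "cmod (of_real r) < 1" using r by auto
    from this[THEN integrable_ln_cmod_cis, of "-(pi/2)" "pi/2" 1]
    have i: "integrable lborel (\<lambda>t. indicator {-(pi/2)..pi/2} t * ln (cmod (1 + of_real r * cis t)))"
            "integrable lborel (\<lambda>t. indicator {-(pi/2)..pi/2} t * ln (cmod (1 - of_real r * cis t)))"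
      by simp_all
    have "indicator (cball 0 1) (of_real r * cis t) = (1 :: real)" for t
      using r by (simp add: norm_mult)
    then have "(\<integral>\<theta>. indicator {-(pi/2)<..<pi/2} \<theta> * ?f (rcis r \<theta>) \<partial>lborel)
        = (\<integral>t. indicator {-(pi/2)..pi/2} t * ln (cmod (1 + of_real r * cis t))
             - indicator {-(pi/2)..pi/2} t * ln (cmod (1 - of_real r * cis t)) \<partial>lborel)"
      by (intro integral_cong_AE)
         (use indicator_Ioo_Icc_AE[of "-(pi/2)" "pi/2"] in \<open>auto simp: rcis_def right_diff_distrib elim!: eventually_mono\<close>)
    also have "\<dots> = (\<integral>t. indicator {-(pi/2)..pi/2} t * ln (cmod (1 + of_real r * cis t)) \<partial>lborel)
             - (\<integral>t. indicator {-(pi/2)..pi/2} t * ln (cmod (1 - of_real r * cis t)) \<partial>lborel)"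
      using i by (rule Bochner_Integration.integral_diff)
    finally have eq: "(\<integral>\<theta>. indicator {-(pi/2)<..<pi/2} \<theta> * ?f (rcis r \<theta>) \<partial>lborel) = \<dots>" .
    have "(\<lambda>n. 2 * (?X n * r ^ n) - 2 * (?X n * (- r) ^ n)) sums
        (\<integral>\<theta>. indicator {-(pi/2)<..<pi/2} \<theta> * ?f (rcis r \<theta>) \<partial>lborel)"
      unfolding eq
      using sums_diff[OF integral_ln_cmod_half_circle_sums[of r] integral_ln_cmod_half_circle_sums[of "-r"]] r
      by simp
    from sums_mult[OF this, of r]
    show ?thesis
    proof (rule sums_cong[THEN iffD1, rotated])
      fix n show "r * (2 * (?X n * r ^ n) - 2 * (?X n * (- r) ^ n)) = ?h n r"
        using r by (cases "even n") (auto simp: chi_m4_even algebra_simps)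
    qed
  qed
  have bd: "\<bar>?X n\<bar> \<le> 1 / (real n)\<^sup>2" for n
    using abs_chi_m4_le[of n] by (simp add: abs_divide divide_right_mono)
  have hbd: "norm (?h n r) \<le> 4 * (1 / (real n)\<^sup>2) * indicator {0..1} r" for n r
  proof (cases "r \<in> {0..1}")
    case True
    then have "\<bar>r ^ (n + 1)\<bar> \<le> 1" using power_le_one[of r "n + 1"] by simp
    then have "\<bar>4 * ?X n\<bar> * \<bar>r ^ (n + 1)\<bar> \<le> 4 * (1 / (real n)\<^sup>2) * 1"
      using bd[of n] by (intro mult_mono) auto
    then show ?thesis using True by (simp add: abs_mult)
  qed auto
  have hint: "integrable lborel (?h n)" for n
  proof (intro integrable_mult_right)
    have "continuous_on {0..1::real} (\<lambda>r. r ^ (n + 1))" by (intro continuous_intros)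
    from borel_integrable_compact[OF _ this]
    show "integrable lborel (\<lambda>r::real. r ^ (n + 1) * indicator {0..1} r)"
      by (simp add: mult.commute)
  qed
  have summ: "summable (\<lambda>n. 4 * (1 / (real n)\<^sup>2))"
    by (rule summable_mult[OF summable_inverse_squares_nat])
  have "(\<lambda>n. integral\<^sup>L lborel (?h n)) sums (\<integral>r. (\<Sum>n. ?h n r) \<partial>lborel)"
  proof (rule sums_integral[OF hint])
    show "AE r in lborel. summable (\<lambda>n. norm (?h n r))"
      by (intro AE_I2 summable_comparison_test'[OF summable_mult2[OF summ], of 0]) (use hbd in simp)
    show "summable (\<lambda>n. \<integral>r. norm (?h n r) \<partial>lborel)"
    proof (rule summable_comparison_test'[OF summ, of 0])
      fix n
      have i: "integrable lborel (\<lambda>r. 4 * (1 / (real n)\<^sup>2) * indicator {0..1::real} r)"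
        by (intro integrable_mult_right integrable_real_indicator) (auto simp: emeasure_lborel_Icc_eq)
      have "(\<integral>r. norm (?h n r) \<partial>lborel) \<le> (\<integral>r. 4 * (1 / (real n)\<^sup>2) * indicator {0..1::real} r \<partial>lborel)"
        by (rule integral_mono[OF integrable_norm[OF hint] i hbd])
      then show "norm (\<integral>r. norm (?h n r) \<partial>lborel) \<le> 4 * (1 / (real n)\<^sup>2)"
        by simp
    qed
  qed
  moreover have "integral\<^sup>L lborel (?h n) = 4 * (chi_m4 n / ((real n)\<^sup>2 * (real n + 2)))" for n
    using integral_power[of 0 1 "n + 1"] by (simp add: divide_divide_eq_left add.commute)
  moreover have "(\<integral>r. (\<Sum>n. ?h n r) \<partial>lborel) = (\<integral>z. indicator {z. 0 < Re z} z * ?f z \<partial>lborel)"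
  proof -
    have "(\<integral>z. indicator {z. 0 < Re z} z * ?f z \<partial>lborel)
       = (\<integral>r. indicator {0<..} r * r * (\<integral>\<theta>. indicator {-(pi/2)<..<pi/2} \<theta> * ?f (rcis r \<theta>) \<partial>lborel) \<partial>lborel)"
      by (rule integral_half_plane_polar[OF _ int]) measurable
    also have "\<dots> = (\<integral>r. (\<Sum>n. ?h n r) \<partial>lborel)"
    proof (rule integral_cong_AE)
      show "AE r in lborel. indicator {0<..} r * r * (\<integral>\<theta>. indicator {-(pi/2)<..<pi/2} \<theta> * ?f (rcis r \<theta>) \<partial>lborel)
         = (\<Sum>n. ?h n r)"
        using AE_lborel_singleton[of 1]
      proof eventually_elim
        case (elim r)
        show ?case
        proof (cases "r \<in> {0<..<1}")
          case True
          then show ?thesis using sums_unique[OF inner[of r]] by simp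
        next
          case False
          then have "r \<le> 0 \<or> 1 < r" using elim by auto
          then show ?thesis by (cases "r = 0") (auto simp: indicator_def)
        qed
      qed
    qed measurable
    finally show ?thesis by simp
  qed
  ultimately have "(\<lambda>n. 4 * (chi_m4 n / ((real n)\<^sup>2 * (real n + 2)))) sums (\<integral>z. indicator {z. 0 < Re z} z * ?f z \<partial>lborel)"
    by simp
  moreover have "(\<lambda>n. 4 * (chi_m4 n / ((real n)\<^sup>2 * (real n + 2)))) sums (4 * (L_chi_m4 2 / 2 - pi / 8 + 1 / 4))"
    by (rule sums_mult[OF chi_m4_cubic_sums])
  ultimately have "(\<integral>z. indicator {z. 0 < Re z} z * ?f z \<partial>lborel) = 4 * (L_chi_m4 2 / 2 - pi / 8 + 1 / 4)"
    by (rule sums_unique2)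
  then show "(\<integral>z. indicator {z. 0 < Re z} z * ?f z \<partial>lborel) = 2 * L_chi_m4 2 - pi / 2 + 1"
    by simp
qed

section \<open>Averages on the boundary half circle\<close>

lemma cmod_one_plus_real_cis_ge:
  assumes "0 \<le> r" "t \<in> {-(pi/2)..pi/2}"
  shows "1 \<le> cmod (1 + of_real r * cis t)"
proof -
  have "0 \<le> cos t" using assms(2) by (intro cos_ge_zero) auto
  then have "1 \<le> Re (1 + of_real r * cis t)" using assms(1) by simp
  then show ?thesis using complex_Re_le_cmod order_trans by blast
qed

text \<open>The power series is only available inside the unit disc; the half circle avoids the
  singularity at \<open>-1\<close>, so the radius may tend to \<open>1\<close>.\<close>

lemma integral_ln_cmod_half_circle:
  "(\<integral>t. indicator {-(pi/2)..pi/2} t * ln (cmod (1 + cis t)) \<partial>lborel) = 2 * L_chi_m4 2"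
proof -
  let ?X = "\<lambda>n. chi_m4 n / (real n)\<^sup>2"
  define r where "r k = 1 - 1 / real (Suc k)" for k
  have r: "0 \<le> r k" "r k < 1" for k by (auto simp: r_def)
  have lim: "r \<longlonglongrightarrow> 1"
    using tendsto_diff[OF tendsto_const LIMSEQ_Suc[OF lim_1_over_n], of 1] by (simp add: r_def[abs_def])
  have "(\<lambda>k. \<integral>t. indicator {-(pi/2)..pi/2} t * ln (cmod (1 + of_real (r k) * cis t)) \<partial>lborel)
     \<longlonglongrightarrow> (\<integral>t. indicator {-(pi/2)..pi/2} t * ln (cmod (1 + of_real 1 * cis t)) \<partial>lborel)"
  \<comment> \<open>On the right half circle 1 <= |1 + r e^(it)| <= 2, so the logarithm lies between
    0 and ln 2.\<close>
  proof (rule integral_dominated_convergence[where w="\<lambda>t. indicator {-(pi/2)..pi/2} t * ln 2"])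
    show "integrable lborel (\<lambda>t. indicator {-(pi/2)..pi/2} t * ln 2 :: real)"
      by (intro integrable_mult_left integrable_real_indicator) (auto simp: emeasure_lborel_Icc_eq)
    show "AE t in lborel. (\<lambda>k. indicator {-(pi/2)..pi/2} t * ln (cmod (1 + of_real (r k) * cis t)))
        \<longlonglongrightarrow> indicator {-(pi/2)..pi/2} t * ln (cmod (1 + of_real 1 * cis t))"
    proof (rule AE_I2)
      fix t
      show "(\<lambda>k. indicator {-(pi/2)..pi/2} t * ln (cmod (1 + of_real (r k) * cis t)))
        \<longlonglongrightarrow> indicator {-(pi/2)..pi/2} t * ln (cmod (1 + of_real 1 * cis t))"
      proof (cases "t \<in> {-(pi/2)..pi/2}")
        case True
        then have "cmod (1 + of_real 1 * cis t) \<noteq> 0"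
          using cmod_one_plus_real_cis_ge[of 1 t] by linarith
        then show ?thesis by (intro tendsto_intros lim)
      qed simp
    qed
    show "AE t in lborel. norm (indicator {-(pi/2)..pi/2} t * ln (cmod (1 + of_real (r k) * cis t)))
        \<le> indicator {-(pi/2)..pi/2} t * ln 2" for k
    proof (rule AE_I2)
      fix t
      have "cmod (1 + of_real (r k) * cis t) \<le> cmod 1 + cmod (of_real (r k) * cis t)"
        by (rule norm_triangle_ineq)
      then have "cmod (1 + of_real (r k) * cis t) \<le> 2"
        using r[of k] by (simp add: norm_mult)
      then have "ln (cmod (1 + of_real (r k) * cis t)) \<le> ln 2" if "t \<in> {-(pi/2)..pi/2}"
        using cmod_one_plus_real_cis_ge[OF r(1)[of k] that] by (subst ln_le_cancel_iff) auto
      then show "norm (indicator {-(pi/2)..pi/2} t * ln (cmod (1 + of_real (r k) * cis t)))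
        \<le> indicator {-(pi/2)..pi/2} t * ln 2"
        using cmod_one_plus_real_cis_ge[OF r(1)[of k], of t] by (auto simp: indicator_def)
    qed
  qed measurable
  moreover have "(\<lambda>k. \<integral>t. indicator {-(pi/2)..pi/2} t * ln (cmod (1 + of_real (r k) * cis t)) \<partial>lborel)
      = (\<lambda>k. \<Sum>n. 2 * (?X n * r k ^ n))"
    using r by (intro ext sums_unique integral_ln_cmod_half_circle_sums) simp
  \<comment> \<open>The series side of the limit: Tannery's theorem with majorant 2 / n^2.\<close>
  moreover have "(\<lambda>k. \<Sum>n. 2 * (?X n * r k ^ n)) \<longlonglongrightarrow> (\<Sum>n. 2 * (?X n * 1 ^ n))"
  proof (rule tannerys_theorem[THEN conjunct2, THEN conjunct2])
    show "((\<lambda>k. 2 * (?X n * r k ^ n)) \<longlongrightarrow> 2 * (?X n * 1 ^ n)) sequentially" for n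
      by (intro tendsto_intros lim)
    have "norm (2 * (?X n * r k ^ n)) \<le> 2 * (1 / (real n)\<^sup>2)" for n k
    proof -
      have "\<bar>?X n\<bar> * \<bar>r k ^ n\<bar> \<le> (1 / (real n)\<^sup>2) * 1"
        using abs_chi_m4_le[of n] r[of k]
        by (intro mult_mono) (auto simp: abs_divide divide_right_mono power_abs power_le_one)
      then show ?thesis by (simp add: abs_mult)
    qed
    then show "eventually (\<lambda>(n, k). norm (2 * (?X n * r k ^ n)) \<le> 2 * (1 / (real n)\<^sup>2)) (at_top \<times>\<^sub>F sequentially)"
      by (intro always_eventually) auto
    show "summable (\<lambda>n. 2 * (1 / (real n)\<^sup>2))"
      by (rule summable_mult[OF summable_inverse_squares_nat])
  qed simp
  moreover have "(\<Sum>n. 2 * (?X n * 1 ^ n)) = 2 * L_chi_m4 2"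
    using sums_unique[OF sums_mult[OF L_chi_m4_2_sums, of 2]] by simp
  ultimately show ?thesis
    using LIMSEQ_unique by fastforce
qed

text \<open>By the half-angle formula |1 + e^(it)| = 2 cos (t / 2), which is even in t, so [0, pi/2]
  carries half of the boundary average.\<close>

lemma ln_cos_half_has_integral:
  "((\<lambda>t. ln (2 * cos (t / 2))) has_integral L_chi_m4 2) {0..pi/2}"
proof -
  let ?f = "\<lambda>t::real. ln (2 * cos (t / 2))"
  have pos: "0 < cos (t / 2)" if "t \<in> {-(pi/2)..pi/2}" for t :: real
  proof -
    have "-(pi/2) < t / 2" "t / 2 < pi / 2"
      using that pi_gt_zero unfolding atLeastAtMost_iff by linarith+
    then show ?thesis by (rule cos_gt_zero_pi)
  qed
  have cont: "continuous_on {-(pi/2)..pi/2} ?f"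
    using pos by (intro continuous_intros) force+
  have cmod_eq: "cmod (1 + cis t) = 2 * cos (t / 2)" if "t \<in> {-(pi/2)..pi/2}" for t
  proof -
    have "(cmod (1 + cis t))\<^sup>2 = 1 + 2 * cos t + ((cos t)\<^sup>2 + (sin t)\<^sup>2)"
      by (simp add: cmod_power2 power2_sum del: sin_cos_squared_add2)
    also have "\<dots> = 2 + 2 * cos t" by simp
    also have "\<dots> = (2 * cos (t / 2))\<^sup>2"
      using cos_double_cos[of "t / 2"] by (simp add: power_mult_distrib)
    finally have "(cmod (1 + cis t))\<^sup>2 = (2 * cos (t / 2))\<^sup>2" .
    then show ?thesis by (rule power2_eq_imp_eq) (use pos[OF that] in simp_all)
  qed
  have "set_integrable lborel {-(pi/2)..pi/2} ?f"
    unfolding set_integrable_def by (rule borel_integrable_compact[OF _ cont]) simp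
  from set_borel_integral_eq_integral(2)[OF this]
  have "integral {-(pi/2)..pi/2} ?f = (\<integral>t. indicator {-(pi/2)..pi/2} t * ln (2 * cos (t / 2)) \<partial>lborel)"
    by (simp add: set_lebesgue_integral_def)
  also have "\<dots> = (\<integral>t. indicator {-(pi/2)..pi/2} t * ln (cmod (1 + cis t)) \<partial>lborel)"
    by (intro Bochner_Integration.integral_cong) (auto simp: indicator_def cmod_eq)
  also have "\<dots> = 2 * L_chi_m4 2" by (rule integral_ln_cmod_half_circle)
  finally have "integral {-(pi/2)..pi/2} ?f = 2 * L_chi_m4 2" .
  moreover have "integral {-(pi/2)..0} ?f + integral {0..pi/2} ?f = integral {-(pi/2)..pi/2} ?f"
    by (rule Henstock_Kurzweil_Integration.integral_combine) (auto intro: integrable_continuous_real cont)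
  moreover have "integral {-(pi/2)..0} ?f = integral {0..pi/2} ?f"
    using Henstock_Kurzweil_Integration.integral_reflect_real[of "pi/2" 0 ?f] by simp
  ultimately have "integral {0..pi/2} ?f = L_chi_m4 2" by simp
  moreover have "?f integrable_on {0..pi/2}"
    by (rule integrable_continuous_real[OF continuous_on_subset[OF cont]]) auto
  ultimately show ?thesis using integrable_integral by metis
qed

text \<open>Substituting \<open>u = cos t\<close> and integrating by parts reduces the integral to the one of \<open>ln (2 cos (t / 2))\<close>.\<close>

lemma integral_arctan_chord:
  "integral {0..1} (\<lambda>u. 4 * u / (1 + u) * arctan (sqrt (1 - u\<^sup>2) / (1 + u)))
     = 2 - 4 * L_chi_m4 2 + pi * ln 2"
proof -
  let ?h = "\<lambda>u::real. 4 * u / (1 + u) * arctan (sqrt (1 - u\<^sup>2) / (1 + u))"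
  \<comment> \<open>Here 2 sin t - 2 t cos t is an antiderivative of 2 t sin t, and the last two
    terms are 4 t ln (2 cos (t / 2)) with the logarithm split. The surplus 4 ln (2 cos (t / 2)) in
    the derivative is subtracted again and contributes -4 L.\<close>
  let ?F = "\<lambda>t::real. 2 * sin t - 2 * t * cos t + 4 * t * ln (cos (t / 2)) + 4 * t * ln 2"
  have pos: "0 < cos (t / 2)" if "t \<in> {0..pi/2}" for t :: real
  proof -
    have "-(pi/2) < t / 2" "t / 2 < pi / 2"
      using that pi_gt_zero unfolding atLeastAtMost_iff by linarith+
    then show ?thesis by (rule cos_gt_zero_pi)
  qed
  \<comment> \<open>As cos decreases from 1 to 0, the first of the two integrals is over an empty
    interval and only the negative one remains.\<close>
  have "((\<lambda>t. - sin t *\<^sub>R ?h (cos t)) has_integral (integral {cos 0..cos (pi/2)} ?h - integral {cos (pi/2)..cos 0} ?h)) {0..pi/2}"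
  proof (rule has_integral_substitution_general[where s="{}" and c=0 and d=1])
    show "cos ` {0..pi/2} \<subseteq> {0..1::real}" by (auto intro!: cos_ge_zero)
    show "continuous_on {0..1} ?h" by (intro continuous_intros) auto
  qed (auto intro!: continuous_intros derivative_eq_intros)
  from has_integral_neg[OF this]
  have 1: "((\<lambda>t. - (- sin t *\<^sub>R ?h (cos t))) has_integral integral {0..1} ?h) {0..pi/2}"
    by simp
  have 2: "((\<lambda>t. (2 * t * sin t - 2 * t * tan (t / 2) + 4 * ln (2 * cos (t / 2))) - 4 * ln (2 * cos (t / 2)))
      has_integral (?F (pi/2) - ?F 0) - 4 * L_chi_m4 2) {0..pi/2}"
  proof (intro has_integral_diff has_integral_mult_right ln_cos_half_has_integral fundamental_theorem_of_calculus)
    fix t :: real assume t: "t \<in> {0..pi/2}"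
    have "(?F has_real_derivative 2 * t * sin t - 2 * t * tan (t / 2) + 4 * ln (2 * cos (t / 2))) (at t within {0..pi/2})"
      using pos[OF t] by (auto intro!: derivative_eq_intros simp: tan_def ln_mult field_simps)
    then show "(?F has_vector_derivative 2 * t * sin t - 2 * t * tan (t / 2) + 4 * ln (2 * cos (t / 2))) (at t within {0..pi/2})"
      by (simp add: has_real_derivative_iff_has_vector_derivative)
  qed simp
  have "- (- sin t *\<^sub>R ?h (cos t)) = (2 * t * sin t - 2 * t * tan (t / 2) + 4 * ln (2 * cos (t / 2))) - 4 * ln (2 * cos (t / 2))"
    if t: "t \<in> {0..pi/2}" for t
  proof -
    have s: "0 \<le> sin t" using t by (intro sin_ge_zero) auto
    have c: "0 < cos (t / 2)" by (rule pos[OF t])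
    have cd: "1 + cos t = 2 * (cos (t / 2))\<^sup>2" using cos_double_cos[of "t / 2"] by simp
    have sd: "sin t = 2 * sin (t / 2) * cos (t / 2)" using sin_double[of "t / 2"] by simp
    have th: "sin t / (1 + cos t) = tan (t / 2)"
      using c by (simp add: cd sd tan_def power2_eq_square)
    have "sqrt (1 - (cos t)\<^sup>2) = sin t" using s by (simp add: sin_squared_eq[symmetric])
    moreover have "arctan (tan (t / 2)) = t / 2"
      by (rule arctan_tan) (use t pi_gt_zero in \<open>unfold atLeastAtMost_iff, linarith+\<close>)
    ultimately have "arctan (sqrt (1 - (cos t)\<^sup>2) / (1 + cos t)) = t / 2"
      by (simp only: th)
    then have "- (- sin t *\<^sub>R ?h (cos t)) = 2 * t * cos t * (sin t / (1 + cos t))"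
      by simp
    \<comment> \<open>With q = tan (t / 2), this separates the elementary part (1 + cos t) q = sin t
      from the part that is integrated by parts.\<close>
    also have "2 * t * cos t * q = 2 * t * ((1 + cos t) * q - q)" for q
      by (simp add: algebra_simps)
    also have "(1 + cos t) * (sin t / (1 + cos t)) = sin t"
      using c by (simp add: cd)
    finally show ?thesis by (simp add: th algebra_simps)
  qed
  from has_integral_eq[OF this 1] 2
  have "integral {0..1} ?h = (?F (pi/2) - ?F 0) - 4 * L_chi_m4 2"
    by (rule has_integral_unique)
  also have "\<dots> = 2 - 4 * L_chi_m4 2 + pi * ln 2"
    by (simp add: cos_45 ln_div ln_sqrt algebra_simps)
  finally show ?thesis .
qed

text \<open>For fixed real part u the integrand 2 u / ((1 + u)^2 + v^2) is rational in v and
  integrates to an arctangent over the chord |v| <= sqrt (1 - u^2).\<close>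

lemma integral_cball_Re_over_cmod_square:
  "integrable lborel (\<lambda>z. indicator {z. 0 < Re z} z * (indicator (cball 0 1) z * (2 * Re z / (cmod (1 + z))\<^sup>2)))"
  "(\<integral>z. indicator {z. 0 < Re z} z * (indicator (cball 0 1) z * (2 * Re z / (cmod (1 + z))\<^sup>2)) \<partial>lborel)
     = 2 - 4 * L_chi_m4 2 + pi * ln 2"
proof -
  let ?f = "\<lambda>z. indicator {z. 0 < Re z} z * (indicator (cball 0 1) z * (2 * Re z / (cmod (1 + z))\<^sup>2)) :: real"
  let ?h = "\<lambda>u::real. 4 * u / (1 + u) * arctan (sqrt (1 - u\<^sup>2) / (1 + u))"
  show int: "integrable lborel ?f"
  proof (rule Bochner_Integration.integrable_bound)
    \<comment> \<open>In the right half disc Re z <= 1 <= |1 + z|, so the constant 2 is a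
      majorant.\<close>
    show "integrable lborel (\<lambda>z :: complex. 2 * indicator (cball 0 1) z :: real)"
      by (intro integrable_mult_right integrable_real_indicator) (auto simp: emeasure_lborel_cball_complex)
    show "AE z in lborel. norm (?f z) \<le> norm (2 * indicator (cball 0 1) z :: real)"
    proof (rule AE_I2)
      fix z :: complex
      have "2 * Re z / (cmod (1 + z))\<^sup>2 \<le> 2" if z: "0 < Re z" "cmod z \<le> 1"
      proof -
        have "1 \<le> cmod (1 + z)" using complex_Re_le_cmod[of "1 + z"] z by simp
        then have "1 \<le> (cmod (1 + z))\<^sup>2" by (simp add: one_le_power)
        moreover have "Re z \<le> 1" using complex_Re_le_cmod[of z] z by simp
        ultimately have "2 * Re z \<le> 2 * (cmod (1 + z))\<^sup>2" by linarith
        then show ?thesis using \<open>1 \<le> (cmod (1 + z))\<^sup>2\<close> by (simp add: divide_le_eq)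
      qed
      then show "norm (?f z) \<le> norm (2 * indicator (cball 0 1) z :: real)"
        by (auto simp: indicator_def)
    qed
  qed measurable
  have inner: "(\<integral>v. ?f (Complex u v) \<partial>lborel) = indicator {0..1} u * ?h u" for u
  proof (cases "0 < u \<and> u \<le> 1")
    case True
    define s where "s = sqrt (1 - u\<^sup>2)"
    have u2: "u\<^sup>2 \<le> 1" using True by (simp add: power_le_one)
    have s0: "0 \<le> s" by (simp add: s_def u2)
    have mem: "Complex u v \<in> cball 0 1 \<longleftrightarrow> v \<in> {-s..s}" for v
    proof -
      have "Complex u v \<in> cball 0 1 \<longleftrightarrow> u\<^sup>2 + v\<^sup>2 \<le> 1" by (simp add: cmod_def)
      also have "\<dots> \<longleftrightarrow> v\<^sup>2 \<le> s\<^sup>2" using u2 by (simp add: s_def) linarith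
      also have "\<dots> \<longleftrightarrow> \<bar>v\<bar> \<le> s" using s0 by (simp add: abs_le_square_iff[symmetric])
      finally show ?thesis by auto
    qed
    have "(\<integral>v. ?f (Complex u v) \<partial>lborel) = (\<integral>v. (2 * u / ((1 + u)\<^sup>2 + v\<^sup>2)) * indicator {-s..s} v \<partial>lborel)"
      using True by (intro Bochner_Integration.integral_cong) (auto simp: indicator_def mem[simplified] cmod_power2)
    also have "\<dots> = 2 * u / (1 + u) * arctan (s / (1 + u)) - 2 * u / (1 + u) * arctan (- s / (1 + u))"
    proof (rule integral_FTC_Icc_real)
      fix v
      have *: "0 < (1 + u)\<^sup>2 + v\<^sup>2" using True by (intro add_pos_nonneg) auto
      have "1 + (v / (1 + u))\<^sup>2 = ((1 + u)\<^sup>2 + v\<^sup>2) / (1 + u)\<^sup>2"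
        using True by (simp add: field_simps)
      then have "2 * u / (1 + u) * (inverse (1 + (v / (1 + u))\<^sup>2) * (1 / (1 + u))) = 2 * u / ((1 + u)\<^sup>2 + v\<^sup>2)"
        using True * by (simp add: power2_eq_square del: distrib_left distrib_right)
      moreover have "((\<lambda>v. 2 * u / (1 + u) * arctan (v / (1 + u))) has_real_derivative
          2 * u / (1 + u) * (inverse (1 + (v / (1 + u))\<^sup>2) * (1 / (1 + u)))) (at v)"
        using True by (auto intro!: derivative_eq_intros)
      ultimately show "((\<lambda>v. 2 * u / (1 + u) * arctan (v / (1 + u))) has_real_derivative 2 * u / ((1 + u)\<^sup>2 + v\<^sup>2)) (at v)"
        by simp
      show "isCont (\<lambda>v. 2 * u / ((1 + u)\<^sup>2 + v\<^sup>2)) v"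
        using * by (intro continuous_intros) auto
    qed (use s0 in simp)
    also have "\<dots> = ?h u" by (simp add: arctan_minus s_def)
    finally show ?thesis using True by simp
  next
    case False
    then consider "u < 0" | "u = 0" | "1 < u" by linarith
    then show ?thesis
    proof cases
      case 3
      have "\<not> cmod (Complex u v) \<le> 1" for v
        using complex_Re_le_cmod[of "Complex u v"] 3 by simp
      then show ?thesis using 3 by simp
    qed simp_all
  qed
  have "(\<integral>z. ?f z \<partial>lborel) = (\<integral>u. indicator {0..1} u * ?h u \<partial>lborel)"
    by (subst integral_lborel_complex[OF int]) (simp only: inner)
  also have "\<dots> = integral {0..1} ?h"
  proof -
    have "set_integrable lborel {0..1} ?h"
      unfolding set_integrable_def by (rule borel_integrable_compact) (auto intro!: continuous_intros)
    from set_borel_integral_eq_integral(2)[OF this] show ?thesis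
      by (simp add: set_lebesgue_integral_def)
  qed
  also have "\<dots> = 2 - 4 * L_chi_m4 2 + pi * ln 2" by (rule integral_arctan_chord)
  finally show "(\<integral>z. ?f z \<partial>lborel) = 2 - 4 * L_chi_m4 2 + pi * ln 2" .
qed

subsection \<open>The areal Mahler measure\<close>

lemma areal_mahler2_cayley_eq:
  fixes h :: "complex \<Rightarrow> real"
  defines "h \<equiv> \<lambda>x. indicator (cball 0 1) x * (\<integral>y. indicator (cball 0 1) y * ln (cmod (y + (1 - x) / (1 + x))) \<partial>lborel)"
  shows "integrable lborel h"
    and "areal_mahler2 (\<lambda>x y. y + (1 - x) / (1 + x)) = (1 / pi\<^sup>2) * (\<integral>x. h x \<partial>lborel)"
proof -
  let ?f = "\<lambda>(x, y). indicator (cball 0 1) x * (indicator (cball 0 1) y * ln (cmod (y + (1 - x) / (1 + x)))) :: real"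
  have h: "h = (\<lambda>x. \<integral>y. ?f (x, y) \<partial>lborel)"
    by (simp add: h_def)
  show "integrable lborel h"
    unfolding h by (rule lborel_pair.integrable_fst'[OF integrable_ln_cmod_cayley])
  have "(LINT z : (cball 0 1 \<times> cball 0 1) | lborel. ln (cmod (snd z + (1 - fst z) / (1 + fst z))))
      = (\<integral>p. ?f p \<partial>(lborel \<Otimes>\<^sub>M lborel))"
    unfolding set_lebesgue_integral_def lborel_prod
    by (intro Bochner_Integration.integral_cong) (auto simp: indicator_def)
  also have "\<dots> = (\<integral>x. h x \<partial>lborel)"
    unfolding h by (rule lborel_pair.integral_fst'[OF integrable_ln_cmod_cayley, symmetric])
  finally show "areal_mahler2 (\<lambda>x y. y + (1 - x) / (1 + x)) = (1 / pi\<^sup>2) * (\<integral>x. h x \<partial>lborel)"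
    by (simp add: areal_mahler2_def)
qed

text \<open>Its sign decides which of |a| < 1 and |a| > 1 holds, and its value turns 1 - |a|^2 into
  4 Re x / |1 + x|^2.\<close>

lemma cmod_diff_square: "(cmod (1 + z))\<^sup>2 - (cmod (1 - z))\<^sup>2 = 4 * Re z"
  by (simp add: cmod_power2 power2_sum power2_diff)

theorem theorem1p3:
  shows "areal_mahler2 (\<lambda>x y. y + (1 - x) / (1 + x))
           = 6 / pi * L_chi_m4 2 - ln 2 - 1 / 2 - 1 / pi"
proof -
  define h :: "complex \<Rightarrow> real" where
    "h x = indicator (cball 0 1) x * (\<integral>y. indicator (cball 0 1) y * ln (cmod (y + (1 - x) / (1 + x))) \<partial>lborel)" for x
  let ?I = "\<lambda>z. indicator {z. 0 < Re z} z :: real"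
  let ?D = "\<lambda>z. indicator (cball 0 1) z :: real"
  let ?f1 = "\<lambda>z. ?I z * (?D z * (ln (cmod (1 + z)) - ln (cmod (1 - z))))"
  let ?f2 = "\<lambda>z. ?I z * (?D z * (2 * Re z / (cmod (1 + z))\<^sup>2))"
  have int: "integrable lborel h"
    unfolding h_def[abs_def] by (rule areal_mahler2_cayley_eq(1))
  have "(\<integral>z. h z \<partial>lborel) = (\<integral>z. ?I z * (h z + h (-z)) \<partial>lborel)"
    by (rule integral_lborel_complex_symmetrize(2)[OF int])
  also have "\<dots> = (\<integral>z. pi * (?f1 z - ?f2 z) \<partial>lborel)"
  proof (rule integral_cong_AE)
    show "(\<lambda>z. ?I z * (h z + h (-z))) \<in> borel_measurable lborel"
      by (rule borel_measurable_integrable[OF integral_lborel_complex_symmetrize(1)[OF int]])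
    \<comment> \<open>At z = 1 the transform vanishes for x = z and has its pole for x = -z, so that
      point is left out.\<close>
    show "AE z in lborel. ?I z * (h z + h (-z)) = pi * (?f1 z - ?f2 z)"
      using AE_lborel_singleton[of 1]
    proof eventually_elim
      case (elim z)
      show ?case
      proof (cases "0 < Re z \<and> z \<in> cball 0 1")
        case True
        then have z: "0 < Re z" "z \<in> cball 0 1" "1 + z \<noteq> 0" "1 - z \<noteq> 0"
          using elim by (auto simp: complex_eq_iff)
        have lt: "(cmod (1 - z))\<^sup>2 < (cmod (1 + z))\<^sup>2"
          using cmod_diff_square[of z] z(1) by linarith
        then have lt': "cmod (1 - z) < cmod (1 + z)"
          by (rule power2_less_imp_less) simp
        \<comment> \<open>Here |a| < 1, the quadratic branch.\<close>
        have "h z = pi * ((cmod ((1 - z) / (1 + z)))\<^sup>2 - 1) / 2"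
          using z lt' by (simp add: h_def integral_cball_ln_cmod_add norm_divide)
        also have "(cmod ((1 - z) / (1 + z)))\<^sup>2 - 1 = - (4 * Re z) / (cmod (1 + z))\<^sup>2"
          unfolding norm_divide power_divide using z
          by (simp add: cmod_diff_square[symmetric] diff_divide_distrib)
        finally have h1: "h z = - pi * (2 * Re z / (cmod (1 + z))\<^sup>2)" by simp
        \<comment> \<open>Replacing z by -z inverts a, so the modulus exceeds 1 and the logarithmic
          branch applies.\<close>
        have "h (-z) = pi * ln (cmod ((1 + z) / (1 - z)))"
          using z lt' by (simp add: h_def integral_cball_ln_cmod_add norm_divide)
        also have "ln (cmod ((1 + z) / (1 - z))) = ln (cmod (1 + z)) - ln (cmod (1 - z))"
          using z by (simp add: norm_divide ln_div)
        finally have h2: "h (-z) = pi * (ln (cmod (1 + z)) - ln (cmod (1 - z)))" .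
        show ?thesis using z(1,2) unfolding h1 h2 by (simp add: algebra_simps)
      next
        case False
        then show ?thesis by (auto simp: h_def)
      qed
    qed
  qed measurable
  also have "\<dots> = pi * ((2 * L_chi_m4 2 - pi / 2 + 1) - (2 - 4 * L_chi_m4 2 + pi * ln 2))"
    using integral_cball_ln_cmod_diff integral_cball_Re_over_cmod_square by simp
  finally have "areal_mahler2 (\<lambda>x y. y + (1 - x) / (1 + x))
     = (1 / pi\<^sup>2) * (pi * ((2 * L_chi_m4 2 - pi / 2 + 1) - (2 - 4 * L_chi_m4 2 + pi * ln 2)))"
    unfolding areal_mahler2_cayley_eq(2) h_def by simp
  then show ?thesis by (simp add: field_simps power2_eq_square)
qed

end
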